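(* Assume that the ambiguity correspondences $(\mathcal P_t)_{t\in\mathcal T}$ satisfy: (a) for every $t\in\mathcal T$, $(x,a)\mapsto\mathcal P_t(x,a)\subset\mathcal P(\mathcal X)$ is nonempty- and compact-valued (for $W_q$) and continuous in the Hausdorff distance, i.e. $(x_n,a_n)\to(x,a)$ implies $d_H(\mathcal P_t(x_n,a_n),\mathcal P_t(x,a))\to0$; (b) there is $C_P\ge1$ such that $\int_{\mathcal X}(1+\|x'\|^q)\,\mathbb P(dx')\le C_P(1+\|x\|^q+\|a\|^q)$ for all $(t,x,a)\in\mathcal T\times\mathcal X\times A$ and $\mathbb P\in\mathcal P_t(x,a)$. Assume also that $f(t,\cdot,\cdot,\cdot)$ is continuous on $\mathcal X\times A\times\mathcal X$ for every $t\in\mathcal T$ and that $g$ is continuous on $\mathcal X$. Then: (i) For all $(t,x)\in\mathcal T\times\mathcal X$ and every admissible policy $\pi\in\Pi$, $$V_T^\pi(x)=g(x),\qquad V_t^\pi(x)=\int_A\Big[\inf_{\mathbb P\in\mathcal P_t(x,a)}\int_{\mathcal X}\big(f(t,x,a,x')+V_{t+1}^\pi(x')\big)\,\mathbb P(dx')\Big]\pi_t(x,da).$$ Moreover $V_t^\pi\in C(\mathcal X;\mathbb R)$ for every $t\in\bar{\mathcal T}$ and $\pi\in\Pi$. (ii) For every $\pi\in\Pi$ and every $t\in\mathcal T$ there is a Borel-measurable map $\mathbb P_t^{*,\pi}:\mathcal X\times A\to\mathcal P(\mathcal X)$ with $\mathbb P_t^{*,\pi}(x,a)\in\mathcal P_t(x,a)$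 and $$\inf_{\mathbb P\in\mathcal P_t(x,a)}\int_{\mathcal X}\big[f(t,x,a,x')+V_{t+1}^\pi(x')\big]\mathbb P(dx')=\int_{\mathcal X}\big[f(t,x,a,x')+V_{t+1}^\pi(x')\big]\mathbb P_t^{*,\pi}(x,a,dx')$$ for all $(x,a)\in\mathcal X\times A$. Consequently, for an initial state $x\in\mathcal X$, with the path measure on $\Omega$ $$\mathbb P^{*,\pi}(d\omega):=\delta_x(dx_0)\prod_{t=0}^{T-1}\pi_t(x_t,da_t)\prod_{t=0}^{T-1}\mathbb P_t^{*,\pi}(x_t,a_t,dx_{t+1}),$$ one has $$V_0^\pi(x)=\inf_{\mathbb P\in\mathcal B_{x,\pi}}\mathbb E^{\mathbb P}[R]=\mathbb E^{\mathbb P^{*,\pi}}[R].$$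
   Context: Let $\mathcal X\subset\mathbb R^d$ and $A\subset\mathbb R^m$ be nonempty compact sets with Borel $\sigma$-algebras, $T\ge1$ an integer, $\mathcal T=\{0,\dots,T-1\}$, $\bar{\mathcal T}=\{0,\dots,T\}$, $q\ge1$. $\mathcal P(B)$ denotes Borel probability measures on $B$. $\mathcal P(\mathcal X)$ is endowed with the $q$-Wasserstein metric $W_q$ associated with a metric $d$ on $\mathcal X$ (derived from a Euclidean norm). For nonempty compact $K_1,K_2\subset\mathcal P(\mathcal X)$, $d_H(K_1,K_2)=\sup\{\sup_{\mu\in K_1}\inf_{\nu\in K_2}W_q(\mu,\nu),\ \sup_{\nu\in K_2}\inf_{\mu\in K_1}W_q(\mu,\nu)\}$. For each $t\in\mathcal T$, $\mathcal P_t:\mathcal X\times A\rightrightarrows\mathcal P(\mathcal X)$ is a set-valued transition kernel (ambiguity correspondence). A policy $\pi=(\pi_t)_{t\in\mathcal T}$ is admissible ($\pi\in\Pi$) if for every $t$: $x\mapsto\pi_t(x,da)\in\mathcal P(A)$ is Borel measurable; it is continuous for weak convergence; and there is $C\ge1$ with $\int_A\|a\|^q\pi_t(x,da)\le C(1+\|x\|^q)$ for all $(t,x)$. $\Omega=(\mathcal X\times A)^T\times\mathcal X$ with elements $\omega=(x_0,a_0,\dots,x_{T-1},a_{T-1},x_T)$; $X_t,a_t$ are the coordinate maps. The rewards are Borel functions $f:\mathcal T\times\mathcal X\times A\times\mathcal X\to\mathbb R$ and $g:\mathcal X\to\mathbb R$, and $R(\omega)=\sum_{t=0}^{T-1}f(t,x_t,a_t,x_{t+1})+g(x_T)$.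 For $x\in\mathcal X$, $\pi\in\Pi$, $t\in\bar{\mathcal T}$, $\mathcal B_{x,\pi|t}$ is the set of probability measures on $(\mathcal X\times A)^{T-t}\times\mathcal X$ of the form $\delta_x(dx_t)\prod_{l=t}^{T-1}\pi_l(x_l,da_l)\prod_{l=t}^{T-1}\mathbb P_l(x_l,a_l,dx_{l+1})$, where each $\mathbb P_l:\mathcal X\times A\to\mathcal P(\mathcal X)$ is Borel measurable with $\mathbb P_l(x',a')\in\mathcal P_l(x',a')$ for all $(x',a')$ (empty products equal $1$); $\mathcal B_{x,\pi}:=\mathcal B_{x,\pi|0}$. The robust value function of $\pi$ is $$V_t^\pi(x)=\inf_{\mathbb P\in\mathcal B_{x,\pi|t}}\mathbb E^{\mathbb P}\Big[\sum_{l=t}^{T-1}f(l,X_l,a_l,X_{l+1})+g(X_T)\Big],$$ with the empty sum equal to $0$. *)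

theory Defs
  imports "HOL-Probability.Probability"
begin

abbreviation borel_on :: "'b::topological_space set \<Rightarrow> 'b measure" where
  "borel_on S \<equiv> restrict_space borel S"

text \<open>
  Kernels into the Borel probability measures on \<open>S\<close> are measurable maps into
  \<open>prob_algebra (borel_on S)\<close>. For compact \<open>S\<close> its sigma-algebra is the Borel
  sigma-algebra of the weak topology, equivalently of the Wasserstein metrics.
\<close>

abbreviation prob_on :: "'b::topological_space set \<Rightarrow> 'b measure set" where
  "prob_on S \<equiv> space (prob_algebra (borel_on S))"

definition couplings :: "'b measure \<Rightarrow> 'b measure \<Rightarrow> ('b \<times> 'b) measure set" where
  "couplings \<mu> \<nu> = {\<gamma>. prob_space \<gamma> \<and> sets \<gamma> = sets (\<mu> \<Otimes>\<^sub>M \<nu>) \<and>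
     distr \<gamma> \<mu> fst = \<mu> \<and> distr \<gamma> \<nu> snd = \<nu>}"

definition wasserstein :: "real \<Rightarrow> 'b::metric_space measure \<Rightarrow> 'b measure \<Rightarrow> real" where
  "wasserstein q \<mu> \<nu> =
     (INF \<gamma>\<in>couplings \<mu> \<nu>. \<integral>z. dist (fst z) (snd z) powr q \<partial>\<gamma>) powr (1 / q)"

text \<open>
  The metric topology of the Wasserstein distance. It has the shape of
  \<open>Metric_space.mtopology\<close>, whose defining equation would presuppose the metric axioms;
  the open sets below form a topology without appeal to the triangle inequality.
\<close>

definition wasserstein_topology :: "real \<Rightarrow> 'b::metric_space set \<Rightarrow> 'b measure topology" where
  "wasserstein_topology q S = topology (\<lambda>U. U \<subseteq> prob_on S \<and>
     (\<forall>\<mu>\<in>U. \<exists>r>0. \<forall>\<nu>\<in>prob_on S. wasserstein q \<mu> \<nu> < r \<longrightarrow> \<nu> \<in> U))"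

lemma openin_wasserstein_topology:
  "openin (wasserstein_topology q S) U \<longleftrightarrow> U \<subseteq> prob_on S \<and>
     (\<forall>\<mu>\<in>U. \<exists>r>0. \<forall>\<nu>\<in>prob_on S. wasserstein q \<mu> \<nu> < r \<longrightarrow> \<nu> \<in> U)"
proof -
  let ?ball = "\<lambda>\<mu> r U. \<forall>\<nu>\<in>prob_on S. wasserstein q \<mu> \<nu> < r \<longrightarrow> \<nu> \<in> U"
  have "istopology (\<lambda>U. U \<subseteq> prob_on S \<and> (\<forall>\<mu>\<in>U. \<exists>r>0. ?ball \<mu> r U))"
    unfolding istopology_def
  proof (intro conjI allI impI ballI)
    fix U V \<mu>
    assume U: "U \<subseteq> prob_on S \<and> (\<forall>\<mu>\<in>U. \<exists>r>0. ?ball \<mu> r U)"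
      and V: "V \<subseteq> prob_on S \<and> (\<forall>\<mu>\<in>V. \<exists>r>0. ?ball \<mu> r V)" and \<mu>: "\<mu> \<in> U \<inter> V"
    obtain r where r: "r > 0" "?ball \<mu> r U" using U \<mu> by blast
    obtain s where s: "s > 0" "?ball \<mu> s V" using V \<mu> by blast
    show "\<exists>r>0. ?ball \<mu> r (U \<inter> V)"
      by (rule exI[of _ "min r s"]) (use r s in simp)
  next
    fix \<U> \<mu>
    assume *: "\<forall>U\<in>\<U>. U \<subseteq> prob_on S \<and> (\<forall>\<mu>\<in>U. \<exists>r>0. ?ball \<mu> r U)" and "\<mu> \<in> \<Union> \<U>"
    then obtain U where U: "U \<in> \<U>" "\<mu> \<in> U" by blast
    then obtain r where "r > 0" "?ball \<mu> r U" using * by blast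
    then show "\<exists>r>0. ?ball \<mu> r (\<Union> \<U>)" using U(1) by blast
  qed blast+
  then show ?thesis by (simp add: wasserstein_topology_def topology_inverse')
qed

definition hausdorff_wasserstein ::
    "real \<Rightarrow> 'b::metric_space measure set \<Rightarrow> 'b measure set \<Rightarrow> real" where
  "hausdorff_wasserstein q K1 K2 =
     max (SUP \<mu>\<in>K1. INF \<nu>\<in>K2. wasserstein q \<mu> \<nu>) (SUP \<nu>\<in>K2. INF \<mu>\<in>K1. wasserstein q \<mu> \<nu>)"

definition weakly_converges ::
    "'b::topological_space set \<Rightarrow> (nat \<Rightarrow> 'b measure) \<Rightarrow> 'b measure \<Rightarrow> bool" where
  "weakly_converges S \<mu>s \<mu> \<longleftrightarrow>
     (\<forall>h::'b \<Rightarrow> real. continuous_on S h \<and> bounded (h ` S) \<longrightarrow>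
        (\<lambda>n. \<integral>y. h y \<partial>\<mu>s n) \<longlonglongrightarrow> (\<integral>y. h y \<partial>\<mu>))"

definition admissible ::
    "real \<Rightarrow> 'x::euclidean_space set \<Rightarrow> 'a::euclidean_space set \<Rightarrow> nat \<Rightarrow>
     (nat \<Rightarrow> 'x \<Rightarrow> 'a measure) \<Rightarrow> bool" where
  "admissible q X A T \<pi> \<longleftrightarrow>
     (\<forall>t<T. \<pi> t \<in> borel_on X \<rightarrow>\<^sub>M prob_algebra (borel_on A)) \<and>
     (\<forall>t<T. \<forall>x\<in>X. \<forall>xs. (\<forall>n. xs n \<in> X) \<and> xs \<longlonglongrightarrow> x \<longrightarrow>
        weakly_converges A (\<lambda>n. \<pi> t (xs n)) (\<pi> t x)) \<and>
     (\<exists>C\<ge>1. \<forall>t<T. \<forall>x\<in>X. (\<integral>a. norm a powr q \<partial>\<pi> t x) \<le> C * (1 + norm x powr q))"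

text \<open>
  A path \<open>(x\<^sub>t, a\<^sub>t, \<dots>, x\<^sub>T)\<close> in \<open>(X \<times> A)\<^sup>T\<^sup>-\<^sup>t \<times> X\<close> is a pair \<open>(h, y)\<close> with
  \<open>h l = (x\<^sub>l, a\<^sub>l)\<close> for \<open>t \<le> l < T\<close> (absolute time indices) and \<open>y = x\<^sub>T\<close>.
\<close>

type_synonym ('x, 'a) path = "(nat \<Rightarrow> 'x \<times> 'a) \<times> 'x"

definition path_space ::
    "'x::euclidean_space set \<Rightarrow> 'a::euclidean_space set \<Rightarrow> nat \<Rightarrow> nat \<Rightarrow> ('x, 'a) path measure" where
  "path_space X A t T = (\<Pi>\<^sub>M l\<in>{t..<T}. borel_on (X \<times> A)) \<Otimes>\<^sub>M borel_on X"

definition state_at :: "nat \<Rightarrow> nat \<Rightarrow> ('x, 'a) path \<Rightarrow> 'x" where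
  "state_at T l \<omega> = (if l < T then fst (fst \<omega> l) else snd \<omega>)"

definition action_at :: "nat \<Rightarrow> ('x, 'a) path \<Rightarrow> 'a" where
  "action_at l \<omega> = snd (fst \<omega> l)"

definition reward ::
    "nat \<Rightarrow> (nat \<Rightarrow> 'x \<Rightarrow> 'a \<Rightarrow> 'x \<Rightarrow> real) \<Rightarrow> ('x \<Rightarrow> real) \<Rightarrow> nat \<Rightarrow> ('x, 'a) path \<Rightarrow> real" where
  "reward T f g t \<omega> =
     (\<Sum>l=t..<T. f l (state_at T l \<omega>) (action_at l \<omega>) (state_at T (Suc l) \<omega>)) + g (state_at T T \<omega>)"

text \<open>
  \<open>path_steps X A \<pi> P n t x\<close> is the law of the path started in \<open>x\<close> at time \<open>t\<close> and run for
  \<open>n\<close> steps, as an iterated kernel product: draw \<open>a\<close> from \<open>\<pi> t x\<close> and \<open>x'\<close> from \<open>P t (x, a)\<close>,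
  continue from \<open>x'\<close> at time \<open>t + 1\<close>, and record \<open>(x, a)\<close> at time \<open>t\<close>.
\<close>

primrec path_steps ::
    "'x::euclidean_space set \<Rightarrow> 'a::euclidean_space set \<Rightarrow> (nat \<Rightarrow> 'x \<Rightarrow> 'a measure) \<Rightarrow>
     (nat \<Rightarrow> 'x \<times> 'a \<Rightarrow> 'x measure) \<Rightarrow> nat \<Rightarrow> nat \<Rightarrow> 'x \<Rightarrow> ('x, 'a) path measure" where
  "path_steps X A \<pi> P 0 t x = return (path_space X A t t) (\<lambda>_. undefined, x)"
| "path_steps X A \<pi> P (Suc n) t x =
     \<pi> t x \<bind> (\<lambda>a. P t (x, a) \<bind> (\<lambda>x'.
       distr (path_steps X A \<pi> P n (Suc t) x') (path_space X A t (t + Suc n))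
         (\<lambda>(h, y). (h(t := (x, a)), y))))"

definition path_measure ::
    "'x::euclidean_space set \<Rightarrow> 'a::euclidean_space set \<Rightarrow> nat \<Rightarrow> (nat \<Rightarrow> 'x \<Rightarrow> 'a measure) \<Rightarrow>
     (nat \<Rightarrow> 'x \<times> 'a \<Rightarrow> 'x measure) \<Rightarrow> nat \<Rightarrow> 'x \<Rightarrow> ('x, 'a) path measure" where
  "path_measure X A T \<pi> P t x = path_steps X A \<pi> P (T - t) t x"

definition kernel_selection ::
    "'x::euclidean_space set \<Rightarrow> 'a::euclidean_space set \<Rightarrow> ('x \<Rightarrow> 'a \<Rightarrow> 'x measure set) \<Rightarrow>
     ('x \<times> 'a \<Rightarrow> 'x measure) \<Rightarrow> bool" where
  "kernel_selection X A K P \<longleftrightarrow>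
     P \<in> borel_on (X \<times> A) \<rightarrow>\<^sub>M prob_algebra (borel_on X) \<and> (\<forall>x\<in>X. \<forall>a\<in>A. P (x, a) \<in> K x a)"

definition path_measures ::
    "'x::euclidean_space set \<Rightarrow> 'a::euclidean_space set \<Rightarrow> nat \<Rightarrow>
     (nat \<Rightarrow> 'x \<Rightarrow> 'a \<Rightarrow> 'x measure set) \<Rightarrow> (nat \<Rightarrow> 'x \<Rightarrow> 'a measure) \<Rightarrow> nat \<Rightarrow> 'x \<Rightarrow>
     ('x, 'a) path measure set" where
  "path_measures X A T \<P> \<pi> t x =
     {path_measure X A T \<pi> P t x |P. \<forall>l\<in>{t..<T}. kernel_selection X A (\<P> l) (P l)}"

definition robust_value ::
    "'x::euclidean_space set \<Rightarrow> 'a::euclidean_space set \<Rightarrow> nat \<Rightarrow>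
     (nat \<Rightarrow> 'x \<Rightarrow> 'a \<Rightarrow> 'x measure set) \<Rightarrow> (nat \<Rightarrow> 'x \<Rightarrow> 'a \<Rightarrow> 'x \<Rightarrow> real) \<Rightarrow> ('x \<Rightarrow> real) \<Rightarrow>
     (nat \<Rightarrow> 'x \<Rightarrow> 'a measure) \<Rightarrow> nat \<Rightarrow> 'x \<Rightarrow> real" where
  "robust_value X A T \<P> f g \<pi> t x =
     (INF M\<in>path_measures X A T \<P> \<pi> t x. \<integral>\<omega>. reward T f g t \<omega> \<partial>M)"

end

theory Submission
  imports Defs
begin

text \<open>
  If \<open>wasserstein q \<mu> \<nu> < \<delta>\<close>, some coupling has a small \<open>q\<close>-th moment of the distance, so integrals of
  continuous functions on the compact state space are continuous for the Wasserstein distance. With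
  the Hausdorff continuity of the ambiguity sets the one-step worst case is continuous in \<open>(x, a)\<close>, and
  the weak continuity of the policy carries this over to the Bellman integral.

  Minimizing kernels are selected lexicographically: among the minimizers of the one-step problem,
  one minimizes successively a countable family of integrals that determines a measure. Each of
  these minima is measurable in \<open>(x, a)\<close>, being a limit of penalized minima over the previous
  set of minimizers, and compactness leaves a common minimizer.

  Backward induction then shows that the Bellman integral bounds every expected reward from below
  and is attained along minimizing kernels.
\<close>

section \<open>Wasserstein distance and integrals of continuous functions\<close>

text \<open>An infimum over whole sequences of kernels has to be exchanged with the integrals over
  actions and states. One inequality is monotonicity; the other requires a minimizing kernel that is
  measurable in \<open>(x, a)\<close>, because only measurable kernels generate competing path laws.
  The obstacle is that the set of minimizers may jump as \<open>(x, a)\<close> varies, so the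
  minimum of a second functional over the minimizers of a first one need not be continuous even
  though all data are. Penalization removes the moving constraint:
  \<open>INF (phi + k * psi) - k * INF psi\<close> is taken over the whole ambiguity set, where
  Hausdorff continuity applies, and the limit in \<open>k\<close> preserves measurability although
  it may destroy continuity. Continuity of the value function has to be carried through the
  recursion because it makes the objective of the preceding stage a continuous functional on the
  compact ambiguity sets.\<close>

lemma space_borel_on [simp]: "space (borel_on S) = S"
  by (simp add: space_restrict_space)

lemma prob_onD:
  assumes "\<mu> \<in> prob_on S"
  shows "prob_space \<mu>" "sets \<mu> = sets (borel_on S)" "space \<mu> = S"
  using assms sets_eq_imp_space_eq[of \<mu> "borel_on S"]
  by (auto simp: space_prob_algebra space_restrict_space)

lemma prob_on_measurable:
  assumes "\<mu> \<in> prob_on S" and "h \<in> borel_measurable (borel_on S)"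
  shows "h \<in> borel_measurable \<mu>"
  unfolding measurable_cong_sets[OF prob_onD(2)[OF assms(1)] refl] by (rule assms(2))

lemma compact_continuous_bounded:
  fixes h :: "'b::topological_space \<Rightarrow> real"
  assumes "compact S" and "continuous_on S h"
  obtains B where "B \<ge> 0" "\<And>x. x \<in> S \<Longrightarrow> \<bar>h x\<bar> \<le> B"
proof -
  have "bounded (h ` S)"
    using assms by (intro compact_imp_bounded compact_continuous_image)
  then obtain B where "\<forall>x\<in>S. \<bar>h x\<bar> \<le> B" by (auto simp: bounded_iff)
  then show thesis by (intro that[of "max B 0"]) auto
qed

lemma prob_algebra_integrable:
  fixes h :: "'b \<Rightarrow> real"
  assumes "M \<in> space (prob_algebra N)" "h \<in> borel_measurable N" "\<And>x. x \<in> space N \<Longrightarrow> \<bar>h x\<bar> \<le> B"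
  shows "integrable M h" "\<bar>\<integral>x. h x \<partial>M\<bar> \<le> B"
proof -
  have M: "prob_space M" "sets M = sets N" using assms(1) by (auto simp: space_prob_algebra)
  interpret prob_space M by (fact M)
  have h: "h \<in> borel_measurable M" unfolding measurable_cong_sets[OF M(2) refl] by (rule assms(2))
  have B: "\<And>x. x \<in> space M \<Longrightarrow> \<bar>h x\<bar> \<le> B" using assms(3) sets_eq_imp_space_eq[OF M(2)] by simp
  show int: "integrable M h"
    using h B by (intro integrable_const_bound[where B=B] AE_I2) simp
  have "\<bar>\<integral>x. h x \<partial>M\<bar> \<le> (\<integral>x. \<bar>h x\<bar> \<partial>M)" by (rule integral_abs_bound)
  also have "\<dots> \<le> (\<integral>x. B \<partial>M)" using int B by (intro integral_mono) auto
  also have "\<dots> = B" by (simp add: prob_space)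
  finally show "\<bar>\<integral>x. h x \<partial>M\<bar> \<le> B" .
qed

lemma prob_on_integrable_continuous:
  fixes h :: "'b::topological_space \<Rightarrow> real"
  assumes "compact S" "\<mu> \<in> prob_on S" "continuous_on S h"
  shows "integrable \<mu> h"
proof -
  obtain B where "\<And>x. x \<in> S \<Longrightarrow> \<bar>h x\<bar> \<le> B" using compact_continuous_bounded assms by metis
  then show ?thesis
    using assms
    by (intro prob_algebra_integrable(1)[OF assms(2)] borel_measurable_continuous_on_restrict) auto
qed

lemma prob_on_integral_diff_le:
  fixes h k :: "'b::topological_space \<Rightarrow> real"
  assumes "\<mu> \<in> prob_on S" "integrable \<mu> h" "integrable \<mu> k" "\<And>x. x \<in> S \<Longrightarrow> \<bar>h x - k x\<bar> \<le> e"
  shows "\<bar>(\<integral>x. h x \<partial>\<mu>) - (\<integral>x. k x \<partial>\<mu>)\<bar> \<le> e"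
proof -
  interpret prob_space \<mu> using assms(1) by (rule prob_onD)
  have "\<bar>\<integral>x. h x - k x \<partial>\<mu>\<bar> \<le> (\<integral>x. \<bar>h x - k x\<bar> \<partial>\<mu>)"
    by (rule integral_abs_bound)
  also have "\<dots> \<le> (\<integral>x. e \<partial>\<mu>)"
    using assms prob_onD(3)[OF assms(1)] by (intro integral_mono) auto
  also have "\<dots> = e" by (simp add: prob_space)
  finally show ?thesis using assms by simp
qed

text \<open>Points closer than \<open>d\<close> are handled by uniform continuity; for points at
  least \<open>d\<close> apart the term \<open>L * dist x y powr q\<close> already exceeds the
  oscillation \<open>2 * B\<close>. A bound of this shape integrates against any coupling into the
  transport cost, whatever the modulus of continuity of \<open>h\<close>.\<close>

lemma uniform_modulus_powr:
  fixes h :: "'b::metric_space \<Rightarrow> real"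
  assumes "compact S" "continuous_on S h" "e > 0" "q \<ge> 1"
  obtains L where "L > 0" "\<And>x y. x \<in> S \<Longrightarrow> y \<in> S \<Longrightarrow> \<bar>h x - h y\<bar> \<le> e + L * dist x y powr q"
proof -
  obtain B where B: "B \<ge> 0" "\<And>x. x \<in> S \<Longrightarrow> \<bar>h x\<bar> \<le> B"
    using compact_continuous_bounded assms by metis
  obtain d where d: "d > 0" "\<And>x y. x \<in> S \<Longrightarrow> y \<in> S \<Longrightarrow> dist x y < d \<Longrightarrow> dist (h x) (h y) < e"
    using compact_uniformly_continuous[OF assms(2,1)] \<open>e > 0\<close>
    unfolding uniformly_continuous_on_def by metis
  \<comment> \<open>Chosen so that \<open>L * d powr q = 2 * B + 1\<close>; the summand 1 keeps
    \<open>L\<close> positive when \<open>B = 0\<close>.\<close>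
  define L where "L = (2 * B + 1) / d powr q"
  have L: "L > 0" using B d by (simp add: L_def)
  show thesis
  proof (rule that[OF L])
    fix x y assume xy: "x \<in> S" "y \<in> S"
    show "\<bar>h x - h y\<bar> \<le> e + L * dist x y powr q"
    proof (cases "dist x y < d")
      case True
      then show ?thesis using d(2)[OF xy] L by (auto simp: dist_real_def intro: add_increasing2)
    next
      case False
      have "d powr q \<le> dist x y powr q"
        using False d assms by (intro powr_mono2) auto
      then have "L * d powr q \<le> L * dist x y powr q"
        using L by simp
      then have "2 * B + 1 \<le> L * dist x y powr q"
        using d by (simp add: L_def)
      moreover have "\<bar>h x - h y\<bar> \<le> 2 * B" using B(2)[OF xy(1)] B(2)[OF xy(2)] by linarith
      ultimately show ?thesis using \<open>e > 0\<close> by linarith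
    qed
  qed
qed

lemma couplings_properties:
  assumes "\<gamma> \<in> couplings \<mu> \<nu>" "\<mu> \<in> prob_on S" "\<nu> \<in> prob_on S"
  shows "prob_space \<gamma>" "space \<gamma> = S \<times> S" "fst \<in> \<gamma> \<rightarrow>\<^sub>M \<mu>" "snd \<in> \<gamma> \<rightarrow>\<^sub>M \<nu>"
    "distr \<gamma> \<mu> fst = \<mu>" "distr \<gamma> \<nu> snd = \<nu>"
proof -
  have sets: "sets \<gamma> = sets (\<mu> \<Otimes>\<^sub>M \<nu>)" using assms by (simp add: couplings_def)
  show "space \<gamma> = S \<times> S"
    using sets_eq_imp_space_eq[OF sets] prob_onD[OF assms(2)] prob_onD[OF assms(3)]
    by (simp add: space_pair_measure)
  show "fst \<in> \<gamma> \<rightarrow>\<^sub>M \<mu>" "snd \<in> \<gamma> \<rightarrow>\<^sub>M \<nu>"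
    unfolding measurable_cong_sets[OF sets refl] by simp_all
qed (use assms in \<open>auto simp: couplings_def\<close>)

lemma dist_powr_measurable:
  assumes "\<gamma> \<in> couplings \<mu> \<nu>" "\<mu> \<in> prob_on S" "\<nu> \<in> prob_on S"
  shows "(\<lambda>z. dist (fst z) (snd z :: 'b::{metric_space, second_countable_topology}) powr q) \<in> borel_measurable \<gamma>"
proof -
  have id: "(\<lambda>x. x) \<in> \<mu> \<rightarrow>\<^sub>M borel" "(\<lambda>x. x) \<in> \<nu> \<rightarrow>\<^sub>M borel"
    unfolding measurable_cong_sets[OF prob_onD(2)[OF assms(2)] refl]
      measurable_cong_sets[OF prob_onD(2)[OF assms(3)] refl]
    by (auto intro: measurable_restrict_space1)
  have "fst \<in> \<gamma> \<rightarrow>\<^sub>M borel" "snd \<in> \<gamma> \<rightarrow>\<^sub>M borel"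
    using measurable_compose[OF couplings_properties(3)[OF assms] id(1)]
      measurable_compose[OF couplings_properties(4)[OF assms] id(2)] by auto
  then show ?thesis by measurable
qed

lemma dist_powr_bounded:
  fixes S :: "'b::metric_space set"
  assumes "compact S" "q \<ge> 1"
  obtains D where "D \<ge> 0" "\<And>x y. x \<in> S \<Longrightarrow> y \<in> S \<Longrightarrow> dist x y powr q \<le> D"
proof -
  obtain e where e: "\<And>x y. x \<in> S \<Longrightarrow> y \<in> S \<Longrightarrow> dist x y \<le> e"
    using compact_imp_bounded[OF assms(1)] unfolding bounded_two_points by blast
  have "dist x y powr q \<le> \<bar>e\<bar> powr q" if "x \<in> S" "y \<in> S" for x y
    using e[OF that] assms by (intro powr_mono2) auto
  then show thesis by (intro that[of "\<bar>e\<bar> powr q"]) auto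
qed

lemma dist_powr_integrable:
  fixes S :: "'b::{metric_space, second_countable_topology} set"
  assumes "compact S" "q \<ge> 1" "\<gamma> \<in> couplings \<mu> \<nu>" "\<mu> \<in> prob_on S" "\<nu> \<in> prob_on S"
  shows "integrable \<gamma> (\<lambda>z. dist (fst z) (snd z) powr q)"
proof -
  interpret prob_space \<gamma> using assms(3-) by (rule couplings_properties)
  obtain D where D: "\<And>x y. x \<in> S \<Longrightarrow> y \<in> S \<Longrightarrow> dist x y powr q \<le> D"
    using dist_powr_bounded[OF assms(1,2)] by metis
  show ?thesis
    by (rule integrable_const_bound[where B=D])
      (use D couplings_properties(2)[OF assms(3-)] dist_powr_measurable[OF assms(3-)] in auto)
qed

text \<open>Both integrals are pulled back to the coupling along its projections, where the
  pointwise bound can be integrated; \<open>e\<close> survives unchanged because the coupling has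
  mass one.\<close>

lemma coupling_integral_diff_le:
  fixes S :: "'b::{metric_space, second_countable_topology} set" and h :: "'b \<Rightarrow> real"
  assumes "compact S" "q \<ge> 1" "continuous_on S h"
    and "\<mu> \<in> prob_on S" "\<nu> \<in> prob_on S" "\<gamma> \<in> couplings \<mu> \<nu>"
    and "\<And>x y. x \<in> S \<Longrightarrow> y \<in> S \<Longrightarrow> \<bar>h x - h y\<bar> \<le> e + L * dist x y powr q"
  shows "\<bar>(\<integral>x. h x \<partial>\<mu>) - (\<integral>x. h x \<partial>\<nu>)\<bar> \<le> e + L * (\<integral>z. dist (fst z) (snd z) powr q \<partial>\<gamma>)"
proof -
  note \<gamma> = couplings_properties[OF assms(6,4,5)]
  interpret prob_space \<gamma> by (fact \<gamma>)
  have h: "integrable \<mu> h" "integrable \<nu> h"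
    using prob_on_integrable_continuous assms by auto
  have m: "(\<integral>x. h x \<partial>\<mu>) = (\<integral>z. h (fst z) \<partial>\<gamma>)" "(\<integral>x. h x \<partial>\<nu>) = (\<integral>z. h (snd z) \<partial>\<gamma>)"
    using integral_distr[OF \<gamma>(3), of h] integral_distr[OF \<gamma>(4), of h] h \<gamma>(5,6) by auto
  have i: "integrable \<gamma> (\<lambda>z. h (fst z))" "integrable \<gamma> (\<lambda>z. h (snd z))"
    using integrable_distr[OF \<gamma>(3), of h] integrable_distr[OF \<gamma>(4), of h] h \<gamma>(5,6) by auto
  note d = dist_powr_integrable[OF assms(1,2,6,4,5)]
  have "\<bar>\<integral>z. h (fst z) - h (snd z) \<partial>\<gamma>\<bar> \<le> (\<integral>z. \<bar>h (fst z) - h (snd z)\<bar> \<partial>\<gamma>)"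
    by (rule integral_abs_bound)
  also have "\<dots> \<le> (\<integral>z. e + L * dist (fst z) (snd z) powr q \<partial>\<gamma>)"
    using assms(7) d i \<gamma>(2) by (intro integral_mono) auto
  also have "\<dots> = e + L * (\<integral>z. dist (fst z) (snd z) powr q \<partial>\<gamma>)"
    using d by (simp add: prob_space)
  finally show ?thesis using i by (simp add: m)
qed

text \<open>Guarantees that \<open>couplings\<close> is nonempty, so that the infimum defining
  \<open>wasserstein\<close> is a genuine one.\<close>

lemma product_coupling:
  assumes "\<mu> \<in> prob_on S" "\<nu> \<in> prob_on S"
  shows "\<mu> \<Otimes>\<^sub>M \<nu> \<in> couplings \<mu> \<nu>"
proof -
  interpret M: prob_space \<mu> using assms by (auto dest: prob_onD)
  interpret N: prob_space \<nu> using assms by (auto dest: prob_onD)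
  interpret pair_prob_space \<mu> \<nu> ..
  have 1: "distr (\<mu> \<Otimes>\<^sub>M \<nu>) \<mu> fst = \<mu>" by (rule N.distr_pair_fst)
  \<comment> \<open>The second projection becomes the first one after swapping the factors.\<close>
  have 2: "distr (\<mu> \<Otimes>\<^sub>M \<nu>) \<nu> snd = distr (\<nu> \<Otimes>\<^sub>M \<mu>) \<nu> fst"
    by (subst distr_pair_swap) (simp add: distr_distr comp_def case_prod_beta')
  have 3: "distr (\<nu> \<Otimes>\<^sub>M \<mu>) \<nu> fst = \<nu>" by (rule M.distr_pair_fst)
  show ?thesis using 1 2 3 prob_space_axioms by (simp add: couplings_def)
qed

text \<open>The Hausdorff distance is built from suprema of reals, which are meaningful only when
  bounded above. The product coupling costs at most the bound on \<open>dist x y powr q\<close> over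
  the compact set.\<close>

lemma wasserstein_bounded:
  fixes S :: "'b::{metric_space, second_countable_topology} set"
  assumes "compact S" "q \<ge> 1"
  obtains D where "\<And>\<mu> \<nu>. \<mu> \<in> prob_on S \<Longrightarrow> \<nu> \<in> prob_on S \<Longrightarrow> wasserstein q \<mu> \<nu> \<le> D"
proof -
  obtain D where D: "D \<ge> 0" "\<And>x y. x \<in> S \<Longrightarrow> y \<in> S \<Longrightarrow> dist x y powr q \<le> D"
    using dist_powr_bounded[OF assms] by metis
  have "wasserstein q \<mu> \<nu> \<le> D powr (1/q)" if "\<mu> \<in> prob_on S" "\<nu> \<in> prob_on S" for \<mu> \<nu>
  proof -
    note c = product_coupling[OF that]
    interpret prob_space "\<mu> \<Otimes>\<^sub>M \<nu>" using couplings_properties(1)[OF c that] .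
    have "(INF \<gamma>\<in>couplings \<mu> \<nu>. \<integral>z. dist (fst z) (snd z) powr q \<partial>\<gamma>) \<le> (\<integral>z. dist (fst z) (snd z) powr q \<partial>(\<mu> \<Otimes>\<^sub>M \<nu>))"
      using c by (intro cINF_lower bdd_belowI2[where m=0]) auto
    also have "\<dots> \<le> (\<integral>z. D \<partial>(\<mu> \<Otimes>\<^sub>M \<nu>))"
      using D dist_powr_integrable[OF assms c that] couplings_properties(2)[OF c that]
      by (intro integral_mono) auto
    also have "\<dots> = D" by (simp add: prob_space)
    finally have "(INF \<gamma>\<in>couplings \<mu> \<nu>. \<integral>z. dist (fst z) (snd z) powr q \<partial>\<gamma>) \<le> D" .
    moreover have "0 \<le> (INF \<gamma>\<in>couplings \<mu> \<nu>. \<integral>z. dist (fst z) (snd z) powr q \<partial>\<gamma>)"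
      using c by (intro cINF_greatest) auto
    ultimately show ?thesis
      unfolding wasserstein_def using assms by (intro powr_mono2) auto
  qed
  then show thesis by (rule that)
qed

lemma wasserstein_nonneg: "wasserstein q \<mu> \<nu> \<ge> 0"
  by (simp add: wasserstein_def)

text \<open>A strict bound on an infimum is witnessed by a single coupling. The outer exponent
  \<open>1 / q\<close> is undone first, which uses that the infimum is nonnegative.\<close>

lemma wasserstein_less_imp_coupling:
  assumes "wasserstein q \<mu> \<nu> < r" "\<mu> \<in> prob_on S" "\<nu> \<in> prob_on S" "q \<ge> 1"
  obtains \<gamma> where "\<gamma> \<in> couplings \<mu> \<nu>" "(\<integral>z. dist (fst z) (snd z) powr q \<partial>\<gamma>) < r powr q"
proof -
  let ?I = "INF \<gamma>\<in>couplings \<mu> \<nu>. \<integral>z. dist (fst z) (snd z) powr q \<partial>\<gamma>"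
  note c = product_coupling[OF assms(2,3)]
  have nn: "0 \<le> ?I" using c by (intro cINF_greatest) auto
  have "(?I powr (1/q)) powr q < r powr q"
    using assms by (intro powr_less_mono2) (auto simp: wasserstein_def)
  then have "?I < r powr q" using nn assms by (simp add: powr_powr)
  then show thesis
    using c that by (subst (asm) cINF_less_iff) (auto intro: bdd_belowI2[where m=0])
qed

text \<open>The radius \<open>\<delta>\<close> depends on \<open>h\<close> and \<open>e\<close> but
  not on the measures. This uniformity allows both measures to vary when minima over different
  ambiguity sets are compared.\<close>

lemma wasserstein_integral_close:
  fixes S :: "'b::{metric_space, second_countable_topology} set" and h :: "'b \<Rightarrow> real"
  assumes "compact S" "q \<ge> 1" "continuous_on S h" "e > 0"
  obtains \<delta> where "\<delta> > 0" "\<And>\<mu> \<nu>. \<mu> \<in> prob_on S \<Longrightarrow> \<nu> \<in> prob_on S \<Longrightarrow> wasserstein q \<mu> \<nu> < \<delta> \<Longrightarrow>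
    \<bar>(\<integral>x. h x \<partial>\<mu>) - (\<integral>x. h x \<partial>\<nu>)\<bar> < e"
proof -
  obtain L where L: "L > 0" "\<And>x y. x \<in> S \<Longrightarrow> y \<in> S \<Longrightarrow> \<bar>h x - h y\<bar> \<le> e/2 + L * dist x y powr q"
    using uniform_modulus_powr[OF assms(1,3), of "e/2" q] assms by auto
  \<comment> \<open>Solves \<open>L * \<delta> powr q = e / 2\<close>; the other half of
    \<open>e\<close> is spent on the modulus.\<close>
  define \<delta> where "\<delta> = (e / (2*L)) powr (1/q)"
  have \<delta>: "\<delta> > 0" "\<delta> powr q = e / (2*L)" using L assms by (auto simp: \<delta>_def powr_powr)
  show thesis
  proof (rule that[OF \<delta>(1)])
    fix \<mu> \<nu> assume H: "\<mu> \<in> prob_on S" "\<nu> \<in> prob_on S" "wasserstein q \<mu> \<nu> < \<delta>"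
    obtain \<gamma> where \<gamma>: "\<gamma> \<in> couplings \<mu> \<nu>" "(\<integral>z. dist (fst z) (snd z) powr q \<partial>\<gamma>) < \<delta> powr q"
      using wasserstein_less_imp_coupling[OF H(3,1,2) assms(2)] by metis
    have "L * (\<integral>z. dist (fst z) (snd z) powr q \<partial>\<gamma>) < L * (e / (2*L))"
      using \<gamma>(2) L(1) unfolding \<delta>(2) by (rule mult_strict_left_mono)
    also have "\<dots> = e/2" using L by simp
    finally show "\<bar>(\<integral>x. h x \<partial>\<mu>) - (\<integral>x. h x \<partial>\<nu>)\<bar> < e"
      using coupling_integral_diff_le[OF assms(1-3) H(1,2) \<gamma>(1) L(2)] by linarith
  qed
qed

lemma topspace_wasserstein_topology [simp]: "topspace (wasserstein_topology q S) = prob_on S"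
proof -
  have "openin (wasserstein_topology q S) (prob_on S)"
    unfolding openin_wasserstein_topology by (intro conjI ballI exI[of _ "1::real"] subset_refl impI zero_less_one)
  then have "prob_on S \<subseteq> topspace (wasserstein_topology q S)"
    by (rule openin_subset)
  moreover have "topspace (wasserstein_topology q S) \<subseteq> prob_on S"
    using openin_topspace[of "wasserstein_topology q S"]
    unfolding openin_wasserstein_topology by (rule conjunct1)
  ultimately show ?thesis by (rule antisym[rotated])
qed

text \<open>A set is open when each of its points has a Wasserstein ball inside it, so the uniform
  radius above directly shows that preimages are open. This turns compactness of the ambiguity sets
  into attained minima.\<close>

lemma continuous_map_wasserstein_integral:
  fixes S :: "'b::{metric_space, second_countable_topology} set" and h :: "'b \<Rightarrow> real"
  assumes "compact S" "q \<ge> 1" "continuous_on S h"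
  shows "continuous_map (wasserstein_topology q S) euclideanreal (\<lambda>M. \<integral>x. h x \<partial>M)"
  unfolding continuous_map
proof (intro conjI allI impI)
  fix U :: "real set" assume "openin euclidean U"
  then have U: "open U" by simp
  show "openin (wasserstein_topology q S) {M \<in> topspace (wasserstein_topology q S). (\<integral>x. h x \<partial>M) \<in> U}"
    unfolding openin_wasserstein_topology
  proof (intro conjI ballI)
    fix \<mu> assume "\<mu> \<in> {M \<in> topspace (wasserstein_topology q S). (\<integral>x. h x \<partial>M) \<in> U}"
    then have \<mu>: "\<mu> \<in> prob_on S" "(\<integral>x. h x \<partial>\<mu>) \<in> U" by auto
    obtain e where e: "e > 0" "\<And>y. dist y (\<integral>x. h x \<partial>\<mu>) < e \<Longrightarrow> y \<in> U"
      using U \<mu>(2) unfolding open_dist by blast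
    obtain \<delta> where \<delta>: "\<delta> > 0" "\<And>\<mu> \<nu>. \<mu> \<in> prob_on S \<Longrightarrow> \<nu> \<in> prob_on S \<Longrightarrow> wasserstein q \<mu> \<nu> < \<delta> \<Longrightarrow>
        \<bar>(\<integral>x. h x \<partial>\<mu>) - (\<integral>x. h x \<partial>\<nu>)\<bar> < e"
      using wasserstein_integral_close[OF assms e(1)] by metis
    show "\<exists>r>0. \<forall>\<nu>\<in>prob_on S. wasserstein q \<mu> \<nu> < r \<longrightarrow>
        \<nu> \<in> {M \<in> topspace (wasserstein_topology q S). (\<integral>x. h x \<partial>M) \<in> U}"
    proof (intro exI conjI ballI impI)
      fix \<nu> assume "\<nu> \<in> prob_on S" "wasserstein q \<mu> \<nu> < \<delta>"
      then show "\<nu> \<in> {M \<in> topspace (wasserstein_topology q S). (\<integral>x. h x \<partial>M) \<in> U}"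
        using \<delta>(2)[OF \<mu>(1), of \<nu>] by (auto intro!: e(2) simp: dist_real_def abs_minus_commute)
    qed (fact \<delta>(1))
  qed auto
qed auto

text \<open>The infimal distance from each measure to the other set is at most the Hausdorff
  distance, hence below \<open>r\<close>; strictness then yields an actual nearby measure.\<close>

lemma hausdorff_wasserstein_less:
  fixes S :: "'b::{metric_space, second_countable_topology} set"
  assumes "compact S" "q \<ge> 1" "K1 \<subseteq> prob_on S" "K2 \<subseteq> prob_on S" "K1 \<noteq> {}" "K2 \<noteq> {}"
    and less: "hausdorff_wasserstein q K1 K2 < r"
  shows "\<mu> \<in> K1 \<Longrightarrow> \<exists>\<nu>\<in>K2. wasserstein q \<mu> \<nu> < r"
    and "\<nu> \<in> K2 \<Longrightarrow> \<exists>\<mu>\<in>K1. wasserstein q \<mu> \<nu> < r"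
proof -
  obtain D where D: "\<And>\<mu> \<nu>. \<mu> \<in> prob_on S \<Longrightarrow> \<nu> \<in> prob_on S \<Longrightarrow> wasserstein q \<mu> \<nu> \<le> D"
    using wasserstein_bounded[OF assms(1,2)] by metis
  have bdd: "bdd_below (w ` K)" if "\<And>x. w x \<ge> 0" for w :: "'b measure \<Rightarrow> real" and K
    using that by (intro bdd_belowI2[where m=0])
  \<comment> \<open>\<open>w\<close> is kept arbitrary so that both halves of the maximum follow:
    once with \<open>wasserstein q\<close>, once with its arguments exchanged.\<close>
  have gen: "\<exists>y\<in>K'. w x y < r"
    if sup: "(SUP x\<in>K. INF y\<in>K'. w x y) < r" and x: "x \<in> K" and ne: "K' \<noteq> {}"
      and w: "\<And>x y. 0 \<le> w x y" "\<And>x y. x \<in> K \<Longrightarrow> y \<in> K' \<Longrightarrow> w x y \<le> D"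
    for w :: "'b measure \<Rightarrow> 'b measure \<Rightarrow> real" and K K' x
  proof -
    obtain y0 where y0: "y0 \<in> K'" using ne by blast
    have "bdd_above ((\<lambda>x. INF y\<in>K'. w x y) ` K)"
    proof (rule bdd_aboveI2)
      fix x assume "x \<in> K"
      have "(INF y\<in>K'. w x y) \<le> w x y0" by (rule cINF_lower[OF bdd[OF w(1)] y0])
      also have "\<dots> \<le> D" using w(2) \<open>x \<in> K\<close> y0 .
      finally show "(INF y\<in>K'. w x y) \<le> D" .
    qed
    then have "(INF y\<in>K'. w x y) \<le> (SUP x\<in>K. INF y\<in>K'. w x y)"
      by (rule cSUP_upper[OF x])
    also note sup
    finally show ?thesis using cINF_less_iff[OF ne bdd[of "w x" K', OF w(1)]] by blast
  qed
  have less': "(SUP \<mu>\<in>K1. INF \<nu>\<in>K2. wasserstein q \<mu> \<nu>) < r" "(SUP \<nu>\<in>K2. INF \<mu>\<in>K1. wasserstein q \<mu> \<nu>) < r"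
    using less by (auto simp: hausdorff_wasserstein_def)
  show "\<exists>\<nu>\<in>K2. wasserstein q \<mu> \<nu> < r" if "\<mu> \<in> K1"
    by (rule gen[OF less'(1) that assms(6) wasserstein_nonneg D]) (use assms in auto)
  show "\<exists>\<mu>\<in>K1. wasserstein q \<mu> \<nu> < r" if "\<nu> \<in> K2"
    by (rule gen[OF less'(2) that assms(5) wasserstein_nonneg D]) (use assms in auto)
qed

section \<open>Lexicographic minimization and measurable selection\<close>

lemma compactin_attains_INF:
  assumes "compactin \<tau> K" "K \<noteq> {}" "continuous_map \<tau> euclideanreal \<phi>"
  shows "bdd_below (\<phi> ` K)" "\<exists>M\<in>K. \<phi> M = (INF M\<in>K. \<phi> M)"
proof -
  have "compact (\<phi> ` K)"
    using image_compactin[OF assms(1,3)] by simp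
  then obtain M where M: "M \<in> K" "\<And>M'. M' \<in> K \<Longrightarrow> \<phi> M \<le> \<phi> M'"
    using compact_attains_inf[of "\<phi> ` K"] assms(2) by auto
  then show bdd: "bdd_below (\<phi> ` K)" by (intro bdd_belowI2[where m="\<phi> M"])
  have "\<phi> M = (INF M\<in>K. \<phi> M)"
    using M assms(2) by (intro antisym cINF_greatest cINF_lower bdd)
  with M(1) show "\<exists>M\<in>K. \<phi> M = (INF M\<in>K. \<phi> M)" by blast
qed

lemma compactin_INF_le:
  assumes "compactin \<tau> K" "continuous_map \<tau> euclideanreal \<phi>" "M \<in> K"
  shows "(INF M\<in>K. \<phi> M) \<le> \<phi> M"
  using compactin_attains_INF(1)[OF assms(1) _ assms(2)] assms(3) by (auto intro: cINF_lower)

lemma compactin_sublevel: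
  assumes "compactin \<tau> K" "continuous_map \<tau> euclideanreal \<phi>"
  shows "compactin \<tau> {M \<in> K. \<phi> M \<le> c}"
proof -
  have "closedin \<tau> {M \<in> topspace \<tau>. \<phi> M \<in> {..c}}"
    by (rule closedin_continuous_map_preimage[OF assms(2)]) simp
  then have "compactin \<tau> (K \<inter> {M \<in> topspace \<tau>. \<phi> M \<in> {..c}})"
    by (rule compact_Int_closedin[OF assms(1)])
  also have "K \<inter> {M \<in> topspace \<tau>. \<phi> M \<in> {..c}} = {M \<in> K. \<phi> M \<le> c}"
    using compactin_subset_topspace[OF assms(1)] by auto
  finally show ?thesis .
qed

definition argmin_on :: "('m \<Rightarrow> real) \<Rightarrow> 'm set \<Rightarrow> 'm set" where
  "argmin_on \<phi> K = {M \<in> K. \<phi> M = (INF M'\<in>K. \<phi> M')}"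

text \<open>Having the minimal value is the same as not exceeding it, so the minimizers form a
  sublevel set and inherit compactness.\<close>

lemma compactin_argmin_on:
  assumes "compactin \<tau> K" "K \<noteq> {}" "continuous_map \<tau> euclideanreal \<phi>"
  shows "compactin \<tau> (argmin_on \<phi> K)" "argmin_on \<phi> K \<noteq> {}"
proof -
  have "argmin_on \<phi> K = {M \<in> K. \<phi> M \<le> (INF M'\<in>K. \<phi> M')}"
    using compactin_INF_le[OF assms(1,3)] by (auto simp: argmin_on_def intro: antisym)
  then show "compactin \<tau> (argmin_on \<phi> K)"
    using compactin_sublevel[OF assms(1,3)] by simp
  show "argmin_on \<phi> K \<noteq> {}"
    using compactin_attains_INF(2)[OF assms] by (auto simp: argmin_on_def)
qed

text \<open>A minimizer of \<open>\<phi>\<close> among the minimizers of \<open>\<psi>\<close> shows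
  that no term of the sequence exceeds the limit. Conversely, the points where \<open>\<phi>\<close>
  undercuts the limit by \<open>e\<close> form a compact set disjoint from the minimizers of
  \<open>\<psi>\<close>. There \<open>\<psi>\<close> exceeds its minimum by a fixed gap, and a large
  factor \<open>k\<close> outweighs whatever \<open>\<phi>\<close> can gain.\<close>

lemma INF_penalty_tendsto:
  assumes K: "compactin \<tau> K" "K \<noteq> {}"
    and \<phi>: "continuous_map \<tau> euclideanreal \<phi>" and \<psi>: "continuous_map \<tau> euclideanreal \<psi>"
  shows "(\<lambda>k. (INF M\<in>K. \<phi> M + real k * \<psi> M) - real k * (INF M\<in>K. \<psi> M))
    \<longlonglongrightarrow> (INF M\<in>argmin_on \<psi> K. \<phi> M)"
proof (rule LIMSEQ_I)
  let ?a = "\<lambda>k. (INF M\<in>K. \<phi> M + real k * \<psi> M) - real k * (INF M\<in>K. \<psi> M)"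
  define m where "m = (INF M\<in>K. \<psi> M)"
  define v where "v = (INF M\<in>argmin_on \<psi> K. \<phi> M)"
  note arg = compactin_argmin_on[OF K \<psi>]
  obtain M0 where M0: "M0 \<in> K" "\<psi> M0 = m" "\<phi> M0 = v"
    using compactin_attains_INF(2)[OF arg \<phi>] by (auto simp: argmin_on_def v_def m_def)
  have cont: "continuous_map \<tau> euclideanreal (\<lambda>M. \<phi> M + real k * \<psi> M)" for k
    by (intro continuous_map_add \<phi> continuous_map_real_mult_left \<psi>)
  have upper: "?a k \<le> v" for k
    using compactin_INF_le[OF K(1) cont M0(1), of k] M0 by (simp add: m_def)
  fix r :: real assume "r > 0"
  define e where "e = r/2"
  have e: "e > 0" "e < r" using \<open>r > 0\<close> by (auto simp: e_def)
  \<comment> \<open>\<open>N\<close> collects the points that undercut the target \<open>v\<close>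
    by at least \<open>e\<close>; the penalty has to exclude them.\<close>
  define N where "N = {M \<in> K. \<phi> M \<le> v - e}"
  have "\<exists>k0. \<forall>k\<ge>k0. \<forall>M\<in>N. v + real k * m \<le> \<phi> M + real k * \<psi> M"
  proof (cases "N = {}")
    case False
    have "compactin \<tau> N" unfolding N_def by (rule compactin_sublevel[OF K(1) \<phi>])
    then obtain M1 where M1: "M1 \<in> N" "\<psi> M1 = (INF M\<in>N. \<psi> M)"
      using compactin_attains_INF(2)[OF _ False \<psi>] by blast
    have min1: "\<psi> M1 \<le> \<psi> M" if "M \<in> N" for M
      unfolding M1(2) using \<open>compactin \<tau> N\<close> \<psi> that by (rule compactin_INF_le)
    obtain b where b: "\<And>M. M \<in> K \<Longrightarrow> b \<le> \<phi> M"
      using compactin_INF_le[OF K(1) \<phi>] by blast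
    define \<delta> where "\<delta> = \<psi> M1 - m"
    have "M1 \<notin> argmin_on \<psi> K"
    proof
      assume "M1 \<in> argmin_on \<psi> K"
      then have "v \<le> \<phi> M1" unfolding v_def by (rule compactin_INF_le[OF arg(1) \<phi>])
      then show False using M1(1) e by (simp add: N_def)
    qed
    then have "\<psi> M1 \<noteq> m" using M1 by (auto simp: argmin_on_def N_def m_def)
    moreover have "m \<le> \<psi> M1"
      unfolding m_def using M1 by (intro compactin_INF_le[OF K(1) \<psi>]) (auto simp: N_def)
    ultimately have \<delta>: "\<delta> > 0" by (simp add: \<delta>_def)
    \<comment> \<open>Beyond \<open>k0\<close> the penalty \<open>k * \<delta>\<close> covers
      \<open>v - b\<close>, a bound on how far \<open>\<phi>\<close> can fall below
      \<open>v\<close>.\<close>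
    obtain k0 :: nat where k0: "(v - b) / \<delta> \<le> real k0" using real_arch_simple by blast
    show ?thesis
    proof (intro exI allI impI ballI)
      fix k M assume k: "k \<ge> k0" and M: "M \<in> N"
      have "(v - b) / \<delta> \<le> real k" using k k0 by linarith
      then have "v - b \<le> real k * \<delta>" using \<delta> by (simp add: field_simps)
      moreover have "real k * (m + \<delta>) \<le> real k * \<psi> M"
        using min1[OF M] by (intro mult_left_mono) (auto simp: \<delta>_def)
      moreover have "b \<le> \<phi> M" using M by (intro b) (simp add: N_def)
      ultimately show "v + real k * m \<le> \<phi> M + real k * \<psi> M" by (simp add: distrib_left)
    qed
  qed auto
  then obtain k0 where k0: "\<And>k M. k \<ge> k0 \<Longrightarrow> M \<in> N \<Longrightarrow> v + real k * m \<le> \<phi> M + real k * \<psi> M"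
    by blast
  have lower: "v - e \<le> ?a k" if k: "k \<ge> k0" for k
  proof -
    have "v - e + real k * m \<le> (INF M\<in>K. \<phi> M + real k * \<psi> M)"
    proof (rule cINF_greatest[OF K(2)])
      fix M assume M: "M \<in> K"
      show "v - e + real k * m \<le> \<phi> M + real k * \<psi> M"
      proof (cases "M \<in> N")
        case True
        then show ?thesis using k0[OF k True] e by linarith
      next
        case False
        have "real k * m \<le> real k * \<psi> M"
          unfolding m_def by (intro mult_left_mono compactin_INF_le[OF K(1) \<psi> M]) simp
        then show ?thesis using False M by (simp add: N_def)
      qed
    qed
    then show ?thesis by (simp add: m_def)
  qed
  have "norm (?a k - v) < r" if "k \<ge> k0" for k
    using upper[of k] lower[OF that] e by (auto simp: abs_less_iff)
  then show "\<exists>n0. \<forall>k\<ge>n0. norm (?a k - (INF M\<in>argmin_on \<psi> K. \<phi> M)) < r"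
    unfolding v_def by blast
qed

primrec lexmin :: "(nat \<Rightarrow> 's \<Rightarrow> 'm \<Rightarrow> real) \<Rightarrow> ('s \<Rightarrow> 'm set) \<Rightarrow> nat \<Rightarrow> 's \<Rightarrow> 'm set" where
  "lexmin \<psi> K 0 s = K s"
| "lexmin \<psi> K (Suc n) s = argmin_on (\<psi> n s) (lexmin \<psi> K n s)"

text \<open>A point common to all levels attains each nested minimum, so
  \<open>\<psi> n s (p s)\<close> is the minimum over level \<open>n\<close>, which is measurable in
  \<open>s\<close>. The class \<open>\<Phi>\<close> is closed under adding multiples because a
  minimum over the next level is a limit of minima of such combinations over the current one. The
  point \<open>p s\<close> itself comes from plain choice; only its values under the
  \<open>\<psi> n\<close> are claimed to be measurable.\<close>

lemma lexicographic_measurable_selection: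
  fixes \<psi> :: "nat \<Rightarrow> 's \<Rightarrow> 'm \<Rightarrow> real"
  assumes K: "\<And>s. s \<in> space N \<Longrightarrow> compactin \<tau> (K s)" "\<And>s. s \<in> space N \<Longrightarrow> K s \<noteq> {}"
    and cont: "\<And>\<phi> s. \<phi> \<in> \<Phi> \<Longrightarrow> s \<in> space N \<Longrightarrow> continuous_map \<tau> euclideanreal (\<phi> s)"
    and closed: "\<And>\<phi> \<psi> k. \<phi> \<in> \<Phi> \<Longrightarrow> \<psi> \<in> \<Phi> \<Longrightarrow> (\<lambda>s M. \<phi> s M + real k * \<psi> s M) \<in> \<Phi>"
    and meas: "\<And>\<phi>. \<phi> \<in> \<Phi> \<Longrightarrow> (\<lambda>s. INF M\<in>K s. \<phi> s M) \<in> borel_measurable N"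
    and \<psi>: "\<And>n. \<psi> n \<in> \<Phi>"
  obtains p where "\<And>s. s \<in> space N \<Longrightarrow> p s \<in> argmin_on (\<psi> 0 s) (K s)"
    "\<And>n. (\<lambda>s. \<psi> n s (p s)) \<in> borel_measurable N"
proof -
  let ?L = "lexmin \<psi> K"
  have L: "compactin \<tau> (?L n s) \<and> ?L n s \<noteq> {}" if "s \<in> space N" for n s
  proof (induction n)
    case 0
    then show ?case using K that by simp
  next
    case (Suc n)
    then show ?case
      using compactin_argmin_on[of \<tau> "?L n s" "\<psi> n s"] cont[OF \<psi> that] by simp
  qed
  have measL: "(\<lambda>s. INF M\<in>?L n s. \<phi> s M) \<in> borel_measurable N" if "\<phi> \<in> \<Phi>" for \<phi> n
    using that
  \<comment> \<open>The step uses the hypothesis for \<open>\<phi> + k * \<psi> n\<close> and for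
    \<open>\<psi> n\<close>, hence the generalization.\<close>
  proof (induction n arbitrary: \<phi>)
    case 0
    then show ?case using meas by simp
  next
    case (Suc n)
    show ?case
    proof (rule borel_measurable_LIMSEQ_real)
      fix s assume "s \<in> space N"
      then show "(\<lambda>k. (INF M\<in>?L n s. \<phi> s M + real k * \<psi> n s M) - real k * (INF M\<in>?L n s. \<psi> n s M))
          \<longlonglongrightarrow> (INF M\<in>?L (Suc n) s. \<phi> s M)"
        unfolding lexmin.simps using L cont Suc.prems \<psi> by (intro INF_penalty_tendsto) auto
    qed (intro borel_measurable_diff borel_measurable_times borel_measurable_const Suc.IH closed Suc.prems \<psi>)
  qed
  have "(\<Inter>n. ?L n s) \<noteq> {}" if s: "s \<in> space N" for s
  proof -
    have mono: "?L (Suc n) s \<subseteq> ?L n s" for n by (auto simp: argmin_on_def)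
    \<comment> \<open>Closedness is taken relative to \<open>K s\<close>: in the arbitrary topology
      \<open>\<tau>\<close> a compact set may fail to be closed, so the nested intersection argument
      runs in the compact subspace.\<close>
    have closedL: "closedin (subtopology \<tau> (K s)) (?L n s)" for n
    proof (induction n)
      case 0
      then show ?case using K(1)[OF s] by (simp add: compactin_subset_topspace closedin_subtopology_refl)
    next
      case (Suc n)
      let ?c = "INF M\<in>?L n s. \<psi> n s M"
      have "closedin (subtopology \<tau> (K s)) {M \<in> topspace (subtopology \<tau> (K s)). \<psi> n s M \<in> {?c}}"
        by (rule closedin_continuous_map_preimage[OF continuous_map_from_subtopology[OF cont[OF \<psi> s]]]) simp
      then have "closedin (subtopology \<tau> (K s)) (?L n s \<inter> {M \<in> topspace (subtopology \<tau> (K s)). \<psi> n s M \<in> {?c}})"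
        by (rule closedin_Int[OF Suc.IH])
      also have "?L n s \<inter> {M \<in> topspace (subtopology \<tau> (K s)). \<psi> n s M \<in> {?c}} = ?L (Suc n) s"
        using closedin_subset[OF Suc.IH] by (auto simp: argmin_on_def)
      finally show ?case .
    qed
    have compact: "compact_space (subtopology \<tau> (K s))" using K(1)[OF s] by (simp add: compactin_subspace)
    have "decseq (\<lambda>n. ?L n s)" using mono by (rule decseq_SucI)
    from compact_space_imp_nest[OF compact closedL conjunct2[OF L[OF s]] this]
    show ?thesis .
  qed
  then have "\<forall>s\<in>space N. \<exists>M. M \<in> (\<Inter>n. ?L n s)" by blast
  then obtain p where "\<forall>s\<in>space N. p s \<in> (\<Inter>n. ?L n s)"
    unfolding bchoice_iff by (elim exE)
  then have p: "\<And>s n. s \<in> space N \<Longrightarrow> p s \<in> ?L n s" by (auto simp del: lexmin.simps)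
  show thesis
  proof (rule that[of p])
    show "p s \<in> argmin_on (\<psi> 0 s) (K s)" if "s \<in> space N" for s
      using p[OF that, of "Suc 0"] by simp
    show "(\<lambda>s. \<psi> n s (p s)) \<in> borel_measurable N" for n
    proof -
      have "\<psi> n s (p s) = (INF M\<in>?L n s. \<psi> n s M)" if "s \<in> space N" for s
        using p[OF that, of "Suc n"] by (simp add: argmin_on_def)
      then show ?thesis using measL[OF \<psi>] by (subst measurable_cong) auto
    qed
  qed
qed

section \<open>Recovering measurability of kernels from countably many integrals\<close>

lemma open_indicator_limit:
  fixes U :: "'b::metric_space set"
  assumes "open U"
  shows "(\<lambda>k. min 1 (real k * infdist x (- U))) \<longlonglongrightarrow> (if - U = {} then 0 else indicator U x)"
proof (cases "x \<in> U \<and> - U \<noteq> {}")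
  case False
  \<comment> \<open>Either \<open>x\<close> lies outside \<open>U\<close>, or \<open>- U\<close> is
    empty and \<open>infdist\<close> to the empty set is 0 by convention; hence the limit 0 when
    \<open>U\<close> is the whole space.\<close>
  then have "infdist x (- U) = 0"
    using infdist_zero[of x "- U"] by (cases "- U = {}") (simp_all add: infdist_def)
  then show ?thesis using False by auto
next
  case True
  then have "infdist x (- U) \<noteq> 0"
    using in_closed_iff_infdist_zero[of "- U" x] assms by auto
  then have pos: "infdist x (- U) > 0" using infdist_nonneg[of x "- U"] by linarith
  obtain k0 :: nat where k0: "1 / infdist x (- U) \<le> real k0" using real_arch_simple by blast
  have "eventually (\<lambda>k. min 1 (real k * infdist x (- U)) = 1) sequentially"
  proof (rule eventually_sequentiallyI)
    fix k assume "k0 \<le> k"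
    then have "1 / infdist x (- U) \<le> real k" using k0 by linarith
    then show "min 1 (real k * infdist x (- U)) = 1" using pos by (simp add: field_simps)
  qed
  then show ?thesis using True by (simp add: tendsto_eventually)
qed

text \<open>Finite intersections of basic open sets form a countable, intersection-stable generator
  of the Borel sets, so a kernel is measurable once its values on these sets are. Their indicators
  are limits of truncated multiples of the distance to the complement, and dominated convergence
  passes measurability from integrals to probabilities. The sequence depends on neither
  \<open>N\<close>, \<open>S\<close> nor \<open>p\<close>.\<close>

lemma measure_determining_sequence:
  obtains h :: "nat \<Rightarrow> 'b::{metric_space, second_countable_topology} \<Rightarrow> real"
  where "\<And>n. continuous_on UNIV (h n)"
    "\<And>N S p. \<lbrakk>S \<in> sets borel; \<And>s. s \<in> space N \<Longrightarrow> p s \<in> prob_on S; \<And>n. (\<lambda>s. \<integral>x. h n x \<partial>p s) \<in> borel_measurable N\<rbrakk>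
       \<Longrightarrow> p \<in> N \<rightarrow>\<^sub>M prob_algebra (borel_on S)"
proof -
  obtain B :: "'b set set" where B: "countable B" "topological_basis B"
    using ex_countable_basis by blast
  define C where "C = Inter ` {b. finite b \<and> b \<subseteq> B}"
  have "countable C"
    unfolding C_def by (intro countable_image countable_Collect_finite_subset B)
  have openC: "open U" if "U \<in> C" for U
    using that topological_basis_open[OF B(2)] by (auto simp: C_def intro!: open_Inter)
  have stable: "Int_stable C"
  proof (rule Int_stableI)
    fix U V assume "U \<in> C" "V \<in> C"
    then obtain a b where "U = \<Inter>a" "V = \<Inter>b" "finite a" "finite b" "a \<subseteq> B" "b \<subseteq> B"
      by (auto simp: C_def)
    then have "U \<inter> V = \<Inter>(a \<union> b)" "finite (a \<union> b)" "a \<union> b \<subseteq> B" by auto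
    then show "U \<inter> V \<in> C" unfolding C_def by blast
  qed
  have borel: "sets (borel :: 'b measure) = sigma_sets UNIV C"
  proof
    have "sets (borel :: 'b measure) = sigma_sets UNIV B"
      by (subst borel_eq_countable_basis[OF B]) simp
    also have "B \<subseteq> C"
    proof
      fix U assume "U \<in> B"
      then show "U \<in> C" unfolding C_def by (intro image_eqI[of _ _ "{U}"]) auto
    qed
    then have "sigma_sets UNIV B \<subseteq> sigma_sets UNIV C" by (rule sigma_sets_mono')
    finally show "sets (borel :: 'b measure) \<subseteq> sigma_sets UNIV C" .
    show "sigma_sets UNIV C \<subseteq> sets (borel :: 'b measure)"
      using openC by (intro sets.sigma_sets_subset[of C borel, simplified]) auto
  qed
  \<comment> \<open>\<open>prod_decode\<close> runs through all pairs of a generator set and an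
    approximation index, merging both into one sequence.\<close>
  define U where "U n = from_nat_into C (fst (prod_decode n))" for n
  define h where "h n x = min 1 (real (snd (prod_decode n)) * infdist x (- U n))" for n and x :: 'b
  show thesis
  proof (rule that[of h])
    show "continuous_on UNIV (h n)" for n
      unfolding h_def by (intro continuous_intros)
    fix N S and p :: "'c \<Rightarrow> 'b measure"
    assume S: "S \<in> sets borel" and p: "\<And>s. s \<in> space N \<Longrightarrow> p s \<in> prob_on S"
      and hm: "\<And>n. (\<lambda>s. \<integral>x. h n x \<partial>p s) \<in> borel_measurable N"
    show "p \<in> N \<rightarrow>\<^sub>M prob_algebra (borel_on S)"
    proof (rule measurable_prob_algebra_generated[where \<Omega>=S and G="(\<inter>) S ` C"])
      show "sets (borel_on S) = sigma_sets S ((\<inter>) S ` C)"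
        unfolding sets_restrict_space borel using S by (intro sigma_sets_Int) (auto simp: borel)
      show "Int_stable ((\<inter>) S ` C)"
      proof (rule Int_stableI)
        fix a b assume "a \<in> (\<inter>) S ` C" "b \<in> (\<inter>) S ` C"
        then obtain V W where "a = S \<inter> V" "b = S \<inter> W" "V \<in> C" "W \<in> C" by auto
        then have "a \<inter> b = S \<inter> (V \<inter> W)" "V \<inter> W \<in> C" using stable by (auto simp: Int_stable_def)
        then show "a \<inter> b \<in> (\<inter>) S ` C" by blast
      qed
      show "(\<inter>) S ` C \<subseteq> Pow S" by auto
      show "prob_space (p s)" "sets (p s) = sets (borel_on S)" if "s \<in> space N" for s
        using prob_onD[OF p[OF that]] by auto
      fix D assume "D \<in> (\<inter>) S ` C"
      then obtain V where V: "V \<in> C" "D = S \<inter> V" by auto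
      show "(\<lambda>s. emeasure (p s) D) \<in> borel_measurable N"
      \<comment> \<open>For \<open>V\<close> the whole space the approximating functions vanish, so
        the probability 1 is inserted directly.\<close>
      proof (cases "- V = {}")
        case True
        then have "emeasure (p s) D = 1" if "s \<in> space N" for s
          using V prob_space.emeasure_space_1[OF prob_onD(1)[OF p[OF that]]] prob_onD(3)[OF p[OF that]]
          by (simp add: Compl_eq_Diff_UNIV) (metis Diff_eq_empty_iff Int_UNIV_right top.extremum_uniqueI)
        then show ?thesis by (subst measurable_cong[where g="\<lambda>_. 1"]) auto
      next
        case False
        obtain i where i: "from_nat_into C i = V"
          using V(1) \<open>countable C\<close> from_nat_into_surj by metis
        have "(\<lambda>s. measure (p s) D) \<in> borel_measurable N"
        proof (rule borel_measurable_LIMSEQ_real)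
          show "(\<lambda>s. \<integral>x. h (prod_encode (i, k)) x \<partial>p s) \<in> borel_measurable N" for k by (rule hm)
          fix s assume s: "s \<in> space N"
          interpret prob_space "p s" using p[OF s] by (rule prob_onD)
          have hk: "h (prod_encode (i, k)) x = min 1 (real k * infdist x (- V))" for k x
            by (simp add: h_def U_def i)
          have D: "D \<in> sets (p s)"
            using prob_onD(2)[OF p[OF s]] V openC by (auto simp: sets_restrict_space)
          have "(\<lambda>k. \<integral>x. h (prod_encode (i, k)) x \<partial>p s) \<longlonglongrightarrow> (\<integral>x. indicator D x \<partial>p s)"
          proof (rule integral_dominated_convergence[where w="\<lambda>_. 1"])
            show "indicator D \<in> borel_measurable (p s)" using D by simp
            show "h (prod_encode (i, k)) \<in> borel_measurable (p s)" for k
            proof (rule prob_on_measurable[OF p[OF s]])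
              show "h (prod_encode (i, k)) \<in> borel_measurable (borel_on S)"
                unfolding h_def by (intro borel_measurable_continuous_on_restrict continuous_intros)
            qed
            show "AE x in p s. (\<lambda>k. h (prod_encode (i, k)) x) \<longlonglongrightarrow> indicator D x"
            proof (rule AE_I2)
              fix x assume "x \<in> space (p s)"
              then have "indicator D x = (if - V = {} then 0 else indicator V x :: real)"
                using False V prob_onD(3)[OF p[OF s]] by (auto simp: indicator_def)
              then show "(\<lambda>k. h (prod_encode (i, k)) x) \<longlonglongrightarrow> indicator D x"
                unfolding hk using open_indicator_limit[OF openC[OF V(1)], of x] by simp
            qed
            show "AE x in p s. norm (h (prod_encode (i, k)) x) \<le> 1" for k
            proof (rule AE_I2)
              fix x
              have "0 \<le> real k * infdist x (- V)" by (simp add: infdist_nonneg)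
              then have "0 \<le> h (prod_encode (i, k)) x" "h (prod_encode (i, k)) x \<le> 1"
                unfolding hk by (auto simp del: zero_le_mult_iff)
              then show "norm (h (prod_encode (i, k)) x) \<le> 1" by simp
            qed
          qed simp
          then show "(\<lambda>k. \<integral>x. h (prod_encode (i, k)) x \<partial>p s) \<longlonglongrightarrow> measure (p s) D"
            using D by simp
        qed
        then have "(\<lambda>s. ennreal (measure (p s) D)) \<in> borel_measurable N" by simp
        moreover have "emeasure (p s) D = ennreal (measure (p s) D)" if "s \<in> space N" for s
        proof -
          interpret prob_space "p s" using p[OF that] by (rule prob_onD)
          show ?thesis by (rule emeasure_eq_measure)
        qed
        ultimately show ?thesis by (subst measurable_cong) auto
      qed
    qed
  qed
qed

section \<open>Continuity of the one-step operators\<close>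

lemma prob_on_integral_abs_le:
  fixes h :: "'b::topological_space \<Rightarrow> real"
  assumes "\<mu> \<in> prob_on S" "integrable \<mu> h" "\<And>x. x \<in> S \<Longrightarrow> \<bar>h x\<bar> \<le> B"
  shows "\<bar>\<integral>x. h x \<partial>\<mu>\<bar> \<le> B"
  using prob_on_integral_diff_le[OF assms(1,2), of "\<lambda>_. 0" B] assms(3) by simp

text \<open>Uniform continuity on the compact product makes the slices converge uniformly in
  \<open>x\<close>, so the error survives integration against measures that change with
  \<open>n\<close>.\<close>

lemma slice_uniformly_close:
  fixes h :: "'s::metric_space \<Rightarrow> 'b::metric_space \<Rightarrow> real"
  assumes "compact Y" "compact S" "continuous_on (Y \<times> S) (\<lambda>(s, x). h s x)"
    and ss: "\<And>n. ss n \<in> Y" "ss \<longlonglongrightarrow> s" and "s \<in> Y" and "e > 0"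
  shows "\<forall>\<^sub>F n in sequentially. \<forall>x\<in>S. \<bar>h (ss n) x - h s x\<bar> < e"
proof -
  have "uniformly_continuous_on (Y \<times> S) (\<lambda>(s, x). h s x)"
    using assms by (intro compact_uniformly_continuous compact_Times)
  then obtain d where d: "d > 0" "\<And>z z'. z \<in> Y \<times> S \<Longrightarrow> z' \<in> Y \<times> S \<Longrightarrow> dist z' z < d \<Longrightarrow>
      dist (case z' of (s, x) \<Rightarrow> h s x) (case z of (s, x) \<Rightarrow> h s x) < e"
    using \<open>e > 0\<close> unfolding uniformly_continuous_on_def by metis
  have "\<forall>\<^sub>F n in sequentially. dist (ss n) s < d"
    using ss(2) d(1) by (rule tendstoD)
  then show ?thesis
  proof (rule eventually_mono, intro ballI)
    fix n x assume "dist (ss n) s < d" "x \<in> S"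
    then show "\<bar>h (ss n) x - h s x\<bar> < e"
      using d(2)[of "(s, x)" "(ss n, x)"] ss(1) \<open>s \<in> Y\<close> by (simp add: dist_Pair_Pair dist_real_def)
  qed
qed

lemma continuous_on_slice:
  assumes "continuous_on (Y \<times> S) (\<lambda>(s, x). h s x)" "s \<in> Y"
  shows "continuous_on S (h s)"
proof -
  have "continuous_on S ((\<lambda>(s, x). h s x) \<circ> (\<lambda>x. (s, x)))"
    using assms by (intro continuous_on_compose continuous_intros continuous_on_subset[OF assms(1)]) auto
  then show ?thesis by (simp add: comp_def)
qed

lemma INF_le_INF_add:
  fixes F G :: "'m \<Rightarrow> real"
  assumes "K \<noteq> {}" "bdd_below (G ` K')" "\<And>\<mu>. \<mu> \<in> K \<Longrightarrow> \<exists>\<nu>\<in>K'. G \<nu> \<le> F \<mu> + c"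
  shows "(INF \<nu>\<in>K'. G \<nu>) \<le> (INF \<mu>\<in>K. F \<mu>) + c"
proof -
  have "(INF \<nu>\<in>K'. G \<nu>) - c \<le> (INF \<mu>\<in>K. F \<mu>)"
  proof (rule cINF_greatest[OF assms(1)])
    fix \<mu> assume "\<mu> \<in> K"
    then obtain \<nu> where "\<nu> \<in> K'" "G \<nu> \<le> F \<mu> + c" using assms(3) by blast
    then show "(INF \<nu>\<in>K'. G \<nu>) - c \<le> F \<mu>" using cINF_lower[OF assms(2), of \<nu>] by linarith
  qed
  then show ?thesis by linarith
qed

text \<open>A continuity result of Berge type for the minimal values. Changing the integrand from
  \<open>h (ss n)\<close> to \<open>h s\<close> costs at most \<open>e\<close>, and moving to a
  Wasserstein-close measure in the other ambiguity set costs at most another \<open>e\<close>. Each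
  of the two inequalities between minima uses one half of the Hausdorff distance.\<close>

lemma continuous_on_INF_integral:
  fixes S :: "'b::{metric_space, second_countable_topology} set" and Y :: "'s::metric_space set"
    and h :: "'s \<Rightarrow> 'b \<Rightarrow> real"
  assumes Y: "compact Y" and S: "compact S" and q: "q \<ge> 1"
    and h: "continuous_on (Y \<times> S) (\<lambda>(s, x). h s x)"
    and K: "\<And>s. s \<in> Y \<Longrightarrow> K s \<subseteq> prob_on S" "\<And>s. s \<in> Y \<Longrightarrow> K s \<noteq> {}"
    and Hausdorff: "\<And>s ss. s \<in> Y \<Longrightarrow> (\<And>n. ss n \<in> Y) \<Longrightarrow> ss \<longlonglongrightarrow> s \<Longrightarrow>
      (\<lambda>n. hausdorff_wasserstein q (K (ss n)) (K s)) \<longlonglongrightarrow> 0"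
  shows "continuous_on Y (\<lambda>s. INF M\<in>K s. \<integral>x. h s x \<partial>M)"
  unfolding continuous_on_sequentially comp_def
proof (intro allI ballI impI)
  fix ss s assume s: "s \<in> Y" and "(\<forall>n. ss n \<in> Y) \<and> ss \<longlonglongrightarrow> s"
  then have ss: "\<And>n. ss n \<in> Y" "ss \<longlonglongrightarrow> s" by auto
  have int: "integrable M (h s')" if "s' \<in> Y" "M \<in> prob_on S" for s' M
    by (rule prob_on_integrable_continuous[OF S that(2) continuous_on_slice[OF h that(1)]])
  have bdd: "bdd_below ((\<lambda>M. \<integral>x. h s' x \<partial>M) ` K s')" if s': "s' \<in> Y" for s'
  proof -
    obtain B where B: "\<And>x. x \<in> S \<Longrightarrow> \<bar>h s' x\<bar> \<le> B"
      using compact_continuous_bounded[OF S continuous_on_slice[OF h s']] by metis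
    have "- B \<le> (\<integral>x. h s' x \<partial>M)" if "M \<in> K s'" for M
      using prob_on_integral_abs_le[of M S "h s'" B] int[OF s'] B K(1)[OF s'] that by force
    then show ?thesis by (rule bdd_belowI2)
  qed
  show "(\<lambda>n. INF M\<in>K (ss n). \<integral>x. h (ss n) x \<partial>M) \<longlonglongrightarrow> (INF M\<in>K s. \<integral>x. h s x \<partial>M)"
  proof (rule tendstoI)
    fix r :: real assume "r > 0"
    \<comment> \<open>Two errors of size \<open>e\<close> occur, and \<open>2 * e\<close> must stay
      strictly below \<open>r\<close>.\<close>
    define e where "e = r/3"
    have e: "e > 0" using \<open>r > 0\<close> by (simp add: e_def)
    obtain \<delta> where \<delta>: "\<delta> > 0" "\<And>\<mu> \<nu>. \<mu> \<in> prob_on S \<Longrightarrow> \<nu> \<in> prob_on S \<Longrightarrow> wasserstein q \<mu> \<nu> < \<delta> \<Longrightarrow>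
        \<bar>(\<integral>x. h s x \<partial>\<mu>) - (\<integral>x. h s x \<partial>\<nu>)\<bar> < e"
      using wasserstein_integral_close[OF S q continuous_on_slice[OF h s] e] by metis
    have "\<forall>\<^sub>F n in sequentially. hausdorff_wasserstein q (K (ss n)) (K s) < \<delta>"
      using order_tendstoD(2)[OF Hausdorff[OF s ss] \<delta>(1)] .
    moreover have "\<forall>\<^sub>F n in sequentially. \<forall>x\<in>S. \<bar>h (ss n) x - h s x\<bar> < e"
      by (rule slice_uniformly_close[OF Y S h ss s e])
    ultimately show "\<forall>\<^sub>F n in sequentially.
        dist (INF M\<in>K (ss n). \<integral>x. h (ss n) x \<partial>M) (INF M\<in>K s. \<integral>x. h s x \<partial>M) < r"
    proof eventually_elim
      case (elim n)
      note H = hausdorff_wasserstein_less[OF S q K(1)[OF ss(1)] K(1)[OF s] K(2)[OF ss(1)] K(2)[OF s] elim(1)]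
      have near: "\<bar>(\<integral>x. h (ss n) x \<partial>M) - (\<integral>x. h s x \<partial>M)\<bar> \<le> e" if "M \<in> prob_on S" for M
        by (rule prob_on_integral_diff_le[OF that int[OF ss(1) that] int[OF s that]])
          (use elim(2) in \<open>auto intro: less_imp_le\<close>)
      have close: "\<bar>(\<integral>x. h (ss n) x \<partial>\<mu>) - (\<integral>x. h s x \<partial>\<nu>)\<bar> \<le> 2 * e"
        if "\<mu> \<in> K (ss n)" "\<nu> \<in> K s" "wasserstein q \<mu> \<nu> < \<delta>" for \<mu> \<nu>
      proof -
        have "\<mu> \<in> prob_on S" "\<nu> \<in> prob_on S" using that K(1) ss(1) s by blast+
        then show ?thesis using near[of \<mu>] \<delta>(2)[of \<mu> \<nu>] that(3) by linarith
      qed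
      have "(INF M\<in>K s. \<integral>x. h s x \<partial>M) \<le> (INF M\<in>K (ss n). \<integral>x. h (ss n) x \<partial>M) + 2 * e"
      proof (rule INF_le_INF_add[OF K(2)[OF ss(1)] bdd[OF s]])
        fix \<mu> assume "\<mu> \<in> K (ss n)"
        then obtain \<nu> where \<nu>: "\<nu> \<in> K s" "wasserstein q \<mu> \<nu> < \<delta>" using H(1) by blast
        then show "\<exists>\<nu>\<in>K s. (\<integral>x. h s x \<partial>\<nu>) \<le> (\<integral>x. h (ss n) x \<partial>\<mu>) + 2 * e"
          using close[OF \<open>\<mu> \<in> K (ss n)\<close> \<nu>] by (intro bexI[of _ \<nu>]) auto
      qed
      moreover have "(INF M\<in>K (ss n). \<integral>x. h (ss n) x \<partial>M) \<le> (INF M\<in>K s. \<integral>x. h s x \<partial>M) + 2 * e"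
      proof (rule INF_le_INF_add[OF K(2)[OF s] bdd[OF ss(1)]])
        fix \<nu> assume "\<nu> \<in> K s"
        then obtain \<mu> where \<mu>: "\<mu> \<in> K (ss n)" "wasserstein q \<mu> \<nu> < \<delta>" using H(2) by blast
        then show "\<exists>\<mu>\<in>K (ss n). (\<integral>x. h (ss n) x \<partial>\<mu>) \<le> (\<integral>x. h s x \<partial>\<nu>) + 2 * e"
          using close[OF \<mu>(1) \<open>\<nu> \<in> K s\<close> \<mu>(2)] by (intro bexI[of _ \<mu>]) auto
      qed
      ultimately show ?case using e unfolding dist_real_def e_def by linarith
    qed
  qed
qed

text \<open>Integrand and measure move together. Weak convergence handles the fixed integrand
  \<open>\<phi> x\<close>; the remaining change of integrand is uniformly small on \<open>A\<close>,
  hence small under every probability measure.\<close>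

lemma continuous_on_kernel_integral:
  fixes X :: "'x::metric_space set" and A :: "'a::metric_space set" and \<phi> :: "'x \<Rightarrow> 'a \<Rightarrow> real"
  assumes X: "compact X" and A: "compact A"
    and \<phi>: "continuous_on (X \<times> A) (\<lambda>(x, a). \<phi> x a)"
    and \<kappa>: "\<And>x. x \<in> X \<Longrightarrow> \<kappa> x \<in> prob_on A"
    and weak: "\<And>x xs. x \<in> X \<Longrightarrow> (\<And>n. xs n \<in> X) \<Longrightarrow> xs \<longlonglongrightarrow> x \<Longrightarrow> weakly_converges A (\<lambda>n. \<kappa> (xs n)) (\<kappa> x)"
  shows "continuous_on X (\<lambda>x. \<integral>a. \<phi> x a \<partial>\<kappa> x)"
  unfolding continuous_on_sequentially comp_def
proof (intro allI ballI impI)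
  fix xs x assume x: "x \<in> X" and "(\<forall>n. xs n \<in> X) \<and> xs \<longlonglongrightarrow> x"
  then have xs: "\<And>n. xs n \<in> X" "xs \<longlonglongrightarrow> x" by auto
  have int: "integrable M (\<phi> x')" if "x' \<in> X" "M \<in> prob_on A" for x' M
    by (rule prob_on_integrable_continuous[OF A that(2) continuous_on_slice[OF \<phi> that(1)]])
  have c: "continuous_on A (\<phi> x)" by (rule continuous_on_slice[OF \<phi> x])
  have "bounded (\<phi> x ` A)" using A c by (intro compact_imp_bounded compact_continuous_image)
  then have 1: "(\<lambda>n. \<integral>a. \<phi> x a \<partial>\<kappa> (xs n)) \<longlonglongrightarrow> (\<integral>a. \<phi> x a \<partial>\<kappa> x)"
    using weak[OF x xs] c unfolding weakly_converges_def by blast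
  have 2: "(\<lambda>n. (\<integral>a. \<phi> (xs n) a \<partial>\<kappa> (xs n)) - (\<integral>a. \<phi> x a \<partial>\<kappa> (xs n))) \<longlonglongrightarrow> 0"
  proof (rule tendstoI)
    fix e :: real assume "e > 0"
    then have "\<forall>\<^sub>F n in sequentially. \<forall>a\<in>A. \<bar>\<phi> (xs n) a - \<phi> x a\<bar> < e/2"
      by (intro slice_uniformly_close[OF X A \<phi> xs x]) simp
    then show "\<forall>\<^sub>F n in sequentially. dist ((\<integral>a. \<phi> (xs n) a \<partial>\<kappa> (xs n)) - (\<integral>a. \<phi> x a \<partial>\<kappa> (xs n))) 0 < e"
    proof eventually_elim
      case (elim n)
      have "\<bar>(\<integral>a. \<phi> (xs n) a \<partial>\<kappa> (xs n)) - (\<integral>a. \<phi> x a \<partial>\<kappa> (xs n))\<bar> \<le> e/2"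
        by (rule prob_on_integral_diff_le[OF \<kappa>[OF xs(1)] int[OF xs(1) \<kappa>[OF xs(1)]] int[OF x \<kappa>[OF xs(1)]]])
          (use elim in \<open>auto intro: less_imp_le\<close>)
      then show ?case using \<open>e > 0\<close> by (simp add: dist_real_def)
    qed
  qed
  show "(\<lambda>n. \<integral>a. \<phi> (xs n) a \<partial>\<kappa> (xs n)) \<longlonglongrightarrow> (\<integral>a. \<phi> x a \<partial>\<kappa> x)"
    using tendsto_add[OF 2 1] by simp
qed

section \<open>Path measures\<close>

text \<open>In second countable spaces pairing is Borel measurable. This links the Borel sets of
  \<open>X \<times> A\<close>, on which the kernels live, with the product of
  \<open>borel_on X\<close> and \<open>borel_on A\<close> that iterated binds produce.\<close>

lemma Pair_measurable_borel_on:
  fixes X :: "'x::second_countable_topology set" and A :: "'a::second_countable_topology set"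
  assumes "u \<in> N \<rightarrow>\<^sub>M borel_on X" "v \<in> N \<rightarrow>\<^sub>M borel_on A"
  shows "(\<lambda>z. (u z, v z)) \<in> N \<rightarrow>\<^sub>M borel_on (X \<times> A)"
proof (rule measurable_restrict_space2)
  show "(\<lambda>z. (u z, v z)) \<in> space N \<rightarrow> X \<times> A"
    using measurable_space[OF assms(1)] measurable_space[OF assms(2)] by (auto simp: space_restrict_space)
  have "u \<in> borel_measurable N" "v \<in> borel_measurable N"
    using assms by (auto simp: measurable_restrict_space2_iff)
  then show "(\<lambda>z. (u z, v z)) \<in> borel_measurable N" by (rule borel_measurable_Pair)
qed

lemma space_path_space:
  "space (path_space X A t T) = (\<Pi>\<^sub>E l\<in>{t..<T}. X \<times> A) \<times> X"
  by (simp add: path_space_def space_pair_measure space_PiM)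

lemma component_measurable:
  assumes "l \<in> {t..<T}"
  shows "(\<lambda>\<omega>. fst \<omega> l) \<in> path_space X A t T \<rightarrow>\<^sub>M borel_on (X \<times> A)"
  unfolding path_space_def
  by (rule measurable_compose[OF measurable_fst measurable_component_singleton[OF assms]])

lemma fst_measurable_borel_on: "fst \<in> borel_on (X \<times> A) \<rightarrow>\<^sub>M borel_on X"
  for X :: "'x::second_countable_topology set" and A :: "'a::second_countable_topology set"
  by (intro measurable_restrict_space2 borel_measurable_continuous_on_restrict continuous_intros) auto

lemma snd_measurable_borel_on: "snd \<in> borel_on (X \<times> A) \<rightarrow>\<^sub>M borel_on A"
  for X :: "'x::second_countable_topology set" and A :: "'a::second_countable_topology set"
  by (intro measurable_restrict_space2 borel_measurable_continuous_on_restrict continuous_intros) auto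

lemma state_at_measurable:
  assumes "t \<le> l"
  shows "state_at T l \<in> path_space X A t T \<rightarrow>\<^sub>M borel_on X"
proof (cases "l < T")
  case True
  then show ?thesis
    unfolding state_at_def
    using measurable_compose[OF component_measurable fst_measurable_borel_on, of l t T] assms by simp
next
  case False
  then show ?thesis unfolding state_at_def by (simp add: path_space_def)
qed

lemma action_at_measurable:
  assumes "l \<in> {t..<T}"
  shows "action_at l \<in> path_space X A t T \<rightarrow>\<^sub>M borel_on A"
  unfolding action_at_def
  by (rule measurable_compose[OF component_measurable[OF assms] snd_measurable_borel_on])

text \<open>The recorded pair \<open>u z\<close> and the tail \<open>v z\<close> may both vary with
  \<open>z\<close>; joint measurability of the path law in \<open>(x, a, x')\<close> calls for this
  form.\<close>

lemma path_cons_measurable: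
  assumes "u \<in> N \<rightarrow>\<^sub>M borel_on (X \<times> A)" "v \<in> N \<rightarrow>\<^sub>M path_space X A (Suc t) (Suc t + n)"
  shows "(\<lambda>z. case v z of (h, y) \<Rightarrow> (h(t := u z), y)) \<in> N \<rightarrow>\<^sub>M path_space X A t (t + Suc n)"
proof -
  have "(\<lambda>z. fst (v z)) \<in> N \<rightarrow>\<^sub>M (\<Pi>\<^sub>M l\<in>{Suc t..<Suc t + n}. borel_on (X \<times> A))"
    "(\<lambda>z. snd (v z)) \<in> N \<rightarrow>\<^sub>M borel_on X"
    using assms(2) unfolding path_space_def by measurable
  moreover have "(\<lambda>z. (fst (v z))(t := u z)) \<in> N \<rightarrow>\<^sub>M (\<Pi>\<^sub>M l\<in>{t..<t + Suc n}. borel_on (X \<times> A))"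
    by (rule measurable_fun_upd[OF _ calculation(1) assms(1)]) auto
  ultimately show ?thesis
    unfolding path_space_def case_prod_beta' by (intro measurable_Pair)
qed

text \<open>Isolates the innermost law of the recursion so that it can be treated as a kernel in all
  of \<open>x\<close>, \<open>a\<close> and \<open>x'\<close>.\<close>

definition path_continuation ::
    "'x::euclidean_space set \<Rightarrow> 'a::euclidean_space set \<Rightarrow> (nat \<Rightarrow> 'x \<Rightarrow> 'a measure) \<Rightarrow>
     (nat \<Rightarrow> 'x \<times> 'a \<Rightarrow> 'x measure) \<Rightarrow> nat \<Rightarrow> nat \<Rightarrow> 'x \<Rightarrow> 'a \<Rightarrow> 'x \<Rightarrow> ('x, 'a) path measure" where
  "path_continuation X A \<pi> P n t x a x' =
     distr (path_steps X A \<pi> P n (Suc t) x') (path_space X A t (t + Suc n)) (\<lambda>(h, y). (h(t := (x, a)), y))"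

lemma path_steps_Suc:
  "path_steps X A \<pi> P (Suc n) t x = \<pi> t x \<bind> (\<lambda>a. P t (x, a) \<bind> path_continuation X A \<pi> P n t x a)"
  by (simp add: path_continuation_def[abs_def])

lemma path_continuation_measurable:
  assumes "path_steps X A \<pi> P n (Suc t) \<in> borel_on X \<rightarrow>\<^sub>M prob_algebra (path_space X A (Suc t) (Suc t + n))"
  shows "(\<lambda>z. path_continuation X A \<pi> P n t (fst (fst z)) (snd (fst z)) (snd z))
    \<in> (borel_on X \<Otimes>\<^sub>M borel_on A) \<Otimes>\<^sub>M borel_on X \<rightarrow>\<^sub>M prob_algebra (path_space X A t (t + Suc n))"
  unfolding path_continuation_def
proof (rule measurable_distr_prob_space2)
  let ?L = "(borel_on X \<Otimes>\<^sub>M borel_on A) \<Otimes>\<^sub>M borel_on X"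
  show "(\<lambda>z. path_steps X A \<pi> P n (Suc t) (snd z)) \<in> ?L \<rightarrow>\<^sub>M prob_algebra (path_space X A (Suc t) (Suc t + n))"
    by (rule measurable_compose[OF measurable_snd assms])
  have "(\<lambda>z. (fst (fst (fst z)), snd (fst (fst z)))) \<in> ?L \<Otimes>\<^sub>M path_space X A (Suc t) (Suc t + n) \<rightarrow>\<^sub>M borel_on (X \<times> A)"
    by (rule Pair_measurable_borel_on) measurable
  from path_cons_measurable[OF this measurable_snd]
  show "(\<lambda>(z, \<omega>). case \<omega> of (h, y) \<Rightarrow> (h(t := (fst (fst z), snd (fst z))), y))
    \<in> ?L \<Otimes>\<^sub>M path_space X A (Suc t) (Suc t + n) \<rightarrow>\<^sub>M path_space X A t (t + Suc n)"
    by (simp add: case_prod_beta')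
qed

lemma bind_path_continuation_measurable:
  assumes "path_steps X A \<pi> P n (Suc t) \<in> borel_on X \<rightarrow>\<^sub>M prob_algebra (path_space X A (Suc t) (Suc t + n))"
    and P: "P t \<in> borel_on (X \<times> A) \<rightarrow>\<^sub>M prob_algebra (borel_on X)"
  shows "(\<lambda>z. P t (fst z, snd z) \<bind> path_continuation X A \<pi> P n t (fst z) (snd z))
    \<in> borel_on X \<Otimes>\<^sub>M borel_on A \<rightarrow>\<^sub>M prob_algebra (path_space X A t (t + Suc n))"
proof (rule measurable_bind_prob_space2)
  show "(\<lambda>z. P t (fst z, snd z)) \<in> borel_on X \<Otimes>\<^sub>M borel_on A \<rightarrow>\<^sub>M prob_algebra (borel_on X)"
    by (rule measurable_compose[OF Pair_measurable_borel_on P]) auto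
  show "(\<lambda>(z, x'). path_continuation X A \<pi> P n t (fst z) (snd z) x')
    \<in> (borel_on X \<Otimes>\<^sub>M borel_on A) \<Otimes>\<^sub>M borel_on X \<rightarrow>\<^sub>M prob_algebra (path_space X A t (t + Suc n))"
    using path_continuation_measurable[OF assms(1)] by (simp add: case_prod_beta')
qed

lemma path_steps_measurable:
  assumes "\<And>l. l \<in> {t..<t + n} \<Longrightarrow> \<pi> l \<in> borel_on X \<rightarrow>\<^sub>M prob_algebra (borel_on A)"
    and "\<And>l. l \<in> {t..<t + n} \<Longrightarrow> P l \<in> borel_on (X \<times> A) \<rightarrow>\<^sub>M prob_algebra (borel_on X)"
  shows "path_steps X A \<pi> P n t \<in> borel_on X \<rightarrow>\<^sub>M prob_algebra (path_space X A t (t + n))"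
  using assms
proof (induction n arbitrary: t)
  case 0
  \<comment> \<open>With no steps the index set is empty, and the constant \<open>undefined\<close>
    function is the only point of the product.\<close>
  have "(\<lambda>x. (\<lambda>_. undefined, x)) \<in> borel_on X \<rightarrow>\<^sub>M path_space X A t t"
    unfolding path_space_def by (intro measurable_Pair measurable_const) (auto simp: space_PiM)
  then show ?case
    using measurable_compose[OF _ measurable_return_prob_space] by simp
next
  case (Suc n)
  have IH: "path_steps X A \<pi> P n (Suc t) \<in> borel_on X \<rightarrow>\<^sub>M prob_algebra (path_space X A (Suc t) (Suc t + n))"
    by (rule Suc.IH) (use Suc.prems in auto)
  have "(\<lambda>x. \<pi> t x \<bind> (\<lambda>a. P t (x, a) \<bind> path_continuation X A \<pi> P n t x a))
      \<in> borel_on X \<rightarrow>\<^sub>M prob_algebra (path_space X A t (t + Suc n))"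
  proof (rule measurable_bind_prob_space2)
    show "\<pi> t \<in> borel_on X \<rightarrow>\<^sub>M prob_algebra (borel_on A)" using Suc.prems(1) by simp
    show "(\<lambda>(x, a). P t (x, a) \<bind> path_continuation X A \<pi> P n t x a)
        \<in> borel_on X \<Otimes>\<^sub>M borel_on A \<rightarrow>\<^sub>M prob_algebra (path_space X A t (t + Suc n))"
      using bind_path_continuation_measurable[where P=P, OF IH Suc.prems(2)] by (simp add: case_prod_beta')
  qed
  then show ?case by (simp only: path_steps_Suc[abs_def])
qed

lemma prob_algebra_integral_bind:
  fixes h :: "'b \<Rightarrow> real"
  assumes "M \<in> space (prob_algebra L)" "k \<in> L \<rightarrow>\<^sub>M prob_algebra N"
    "h \<in> borel_measurable N" "\<And>x. x \<in> space N \<Longrightarrow> \<bar>h x\<bar> \<le> B"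
  shows "(\<integral>x. h x \<partial>(M \<bind> k)) = (\<integral>y. (\<integral>x. h x \<partial>k y) \<partial>M)"
proof (rule integral_bind[OF assms(3,4)])
  have M: "prob_space M" "sets M = sets L" using assms(1) by (auto simp: space_prob_algebra)
  show "finite_measure M" using M(1) by (simp add: prob_space.finite_measure)
  have k: "k \<in> M \<rightarrow>\<^sub>M prob_algebra N" unfolding measurable_cong_sets[OF M(2) refl] by (rule assms(2))
  then show "k \<in> M \<rightarrow>\<^sub>M subprob_algebra N" by (rule measurable_prob_algebraD)
  show "AE y in M. emeasure (k y) (space (k y)) \<le> ennreal 1"
    using measurable_space[OF k] by (intro AE_I2) (auto simp: space_prob_algebra prob_space.emeasure_space_1)
qed

section \<open>Dynamic programming\<close>

text \<open>One admissible policy is fixed, since every claim concerns a single policy; the robust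
  value then depends on time and state only.\<close>

locale robust_control =
  fixes X :: "'x::euclidean_space set" and A :: "'a::euclidean_space set"
    and T :: nat and q :: real
    and \<P> :: "nat \<Rightarrow> 'x \<Rightarrow> 'a \<Rightarrow> 'x measure set"
    and f :: "nat \<Rightarrow> 'x \<Rightarrow> 'a \<Rightarrow> 'x \<Rightarrow> real" and g :: "'x \<Rightarrow> real"
    and \<pi> :: "nat \<Rightarrow> 'x \<Rightarrow> 'a measure"
  assumes compact_X: "compact X" and compact_A: "compact A" and q: "q \<ge> 1"
    and ambiguity_compact: "\<And>t x a. t < T \<Longrightarrow> x \<in> X \<Longrightarrow> a \<in> A \<Longrightarrow>
           \<P> t x a \<noteq> {} \<and> compactin (wasserstein_topology q X) (\<P> t x a)"
    and ambiguity_continuous: "\<And>t x a xs as. t < T \<Longrightarrow> x \<in> X \<Longrightarrow> a \<in> A \<Longrightarrow>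
           (\<And>n. xs n \<in> X) \<Longrightarrow> (\<And>n. as n \<in> A) \<Longrightarrow> (\<lambda>n. (xs n, as n)) \<longlonglongrightarrow> (x, a) \<Longrightarrow>
           (\<lambda>n. hausdorff_wasserstein q (\<P> t (xs n) (as n)) (\<P> t x a)) \<longlonglongrightarrow> 0"
    and f_continuous: "\<And>t. t < T \<Longrightarrow> continuous_on (X \<times> A \<times> X) (\<lambda>(x, a, x'). f t x a x')"
    and g_continuous: "continuous_on X g"
    and admissible: "admissible q X A T \<pi>"
begin

lemma policy_measurable: "t < T \<Longrightarrow> \<pi> t \<in> borel_on X \<rightarrow>\<^sub>M prob_algebra (borel_on A)"
  using admissible by (simp add: admissible_def)

lemma policy_prob_on: "t < T \<Longrightarrow> x \<in> X \<Longrightarrow> \<pi> t x \<in> prob_on A"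
  using measurable_space[OF policy_measurable] by simp

lemma ambiguity_prob_on: "t < T \<Longrightarrow> x \<in> X \<Longrightarrow> a \<in> A \<Longrightarrow> \<P> t x a \<subseteq> prob_on X"
  using ambiguity_compact compactin_subset_topspace by fastforce

definition worst_case :: "nat \<Rightarrow> ('x \<Rightarrow> real) \<Rightarrow> 'x \<Rightarrow> 'a \<Rightarrow> real" where
  "worst_case t v x a = (INF M\<in>\<P> t x a. \<integral>x'. (f t x a x' + v x') \<partial>M)"

definition is_minimizer :: "nat \<Rightarrow> ('x \<Rightarrow> real) \<Rightarrow> ('x \<times> 'a \<Rightarrow> 'x measure) \<Rightarrow> bool" where
  "is_minimizer t v P \<longleftrightarrow> kernel_selection X A (\<P> t) P \<and>
     (\<forall>x\<in>X. \<forall>a\<in>A. worst_case t v x a = (\<integral>x'. (f t x a x' + v x') \<partial>P (x, a)))"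

text \<open>The bracketing \<open>(X \<times> A) \<times> X\<close> separates the parameter
  \<open>(x, a)\<close> from the integration variable, as the continuity result for parametrized
  minima expects.\<close>

lemma stage_reward_continuous:
  assumes "t < T" "continuous_on X v"
  shows "continuous_on ((X \<times> A) \<times> X) (\<lambda>(s, x'). f t (fst s) (snd s) x' + v x')"
proof -
  have "continuous_on ((X \<times> A) \<times> X)
      ((\<lambda>(x, a, x'). f t x a x') \<circ> (\<lambda>z. (fst (fst z), snd (fst z), snd z)))"
    by (intro continuous_on_compose continuous_intros continuous_on_subset[OF f_continuous[OF assms(1)]]) auto
  moreover have "continuous_on ((X \<times> A) \<times> X) (v \<circ> snd)"
    by (intro continuous_on_compose continuous_intros continuous_on_subset[OF assms(2)]) auto
  ultimately show ?thesis
    by (auto simp: comp_def case_prod_beta' intro: continuous_on_add)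
qed

lemma stage_reward_slice_continuous:
  assumes "t < T" "continuous_on X v" "x \<in> X" "a \<in> A"
  shows "continuous_on X (\<lambda>x'. f t x a x' + v x')"
  using continuous_on_slice[OF stage_reward_continuous[OF assms(1,2)], of "(x, a)"] assms(3,4) by simp

text \<open>The integrand is arbitrary, not just the stage reward, because the selection also
  minimizes test functions and penalized combinations.\<close>

lemma ambiguity_INF_continuous:
  fixes h :: "'x \<times> 'a \<Rightarrow> 'x \<Rightarrow> real"
  assumes "t < T" "continuous_on ((X \<times> A) \<times> X) (\<lambda>(s, x'). h s x')"
  shows "continuous_on (X \<times> A) (\<lambda>s. INF M\<in>\<P> t (fst s) (snd s). \<integral>x'. h s x' \<partial>M)"
proof (rule continuous_on_INF_integral[OF compact_Times[OF compact_X compact_A] compact_X q assms(2)])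
  show "\<P> t (fst s) (snd s) \<subseteq> prob_on X" if "s \<in> X \<times> A" for s
    using ambiguity_prob_on[OF assms(1), of "fst s" "snd s"] that by (simp add: mem_Times_iff)
  show "\<P> t (fst s) (snd s) \<noteq> {}" if "s \<in> X \<times> A" for s
    using ambiguity_compact[OF assms(1)] that by auto
  fix s ss assume "s \<in> X \<times> A" "\<And>n. ss n \<in> X \<times> A" "ss \<longlonglongrightarrow> s"
  then show "(\<lambda>n. hausdorff_wasserstein q (\<P> t (fst (ss n)) (snd (ss n))) (\<P> t (fst s) (snd s))) \<longlonglongrightarrow> 0"
    using ambiguity_continuous[OF assms(1), of "fst s" "snd s" "\<lambda>n. fst (ss n)" "\<lambda>n. snd (ss n)"]
    by (auto simp: mem_Times_iff)
qed

lemma worst_case_continuous: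
  assumes "t < T" "continuous_on X v"
  shows "continuous_on (X \<times> A) (\<lambda>(x, a). worst_case t v x a)"
  using ambiguity_INF_continuous[OF assms(1) stage_reward_continuous[OF assms]]
  by (simp add: worst_case_def case_prod_beta')

lemma worst_case_le:
  assumes "t < T" "continuous_on X v" "x \<in> X" "a \<in> A" "M \<in> \<P> t x a"
  shows "worst_case t v x a \<le> (\<integral>x'. (f t x a x' + v x') \<partial>M)"
  unfolding worst_case_def
  by (rule compactin_INF_le[OF conjunct2[OF ambiguity_compact[OF assms(1,3,4)]]
        continuous_map_wasserstein_integral[OF compact_X q stage_reward_slice_continuous[OF assms(1-4)]] assms(5)])

lemma Bellman_continuous:
  assumes "t < T" "continuous_on X v"
  shows "continuous_on X (\<lambda>x. \<integral>a. worst_case t v x a \<partial>\<pi> t x)"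
proof (rule continuous_on_kernel_integral[OF compact_X compact_A worst_case_continuous[OF assms]])
  show "\<pi> t x \<in> prob_on A" if "x \<in> X" for x using policy_prob_on assms(1) that .
  show "weakly_converges A (\<lambda>n. \<pi> t (xs n)) (\<pi> t x)" if "x \<in> X" "\<And>n. xs n \<in> X" "xs \<longlonglongrightarrow> x" for x xs
    using admissible assms(1) that unfolding admissible_def by blast
qed

lemma minimizer_exists:
  assumes t: "t < T" and v: "continuous_on X v"
  obtains P where "is_minimizer t v P"
proof -
  let ?N = "borel_on (X \<times> A)" and ?K = "\<lambda>s. \<P> t (fst s) (snd s)"
  obtain h :: "nat \<Rightarrow> 'x \<Rightarrow> real" where h: "\<And>n. continuous_on UNIV (h n)"
    and h_det: "\<And>N S p. \<lbrakk>S \<in> sets borel; \<And>s. s \<in> space N \<Longrightarrow> p s \<in> prob_on S;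
       \<And>n. (\<lambda>s. \<integral>x. h n x \<partial>p s) \<in> borel_measurable N\<rbrakk> \<Longrightarrow> (p :: 'x \<times> 'a \<Rightarrow> _) \<in> N \<rightarrow>\<^sub>M prob_algebra (borel_on S)"
    using measure_determining_sequence by metis
  \<comment> \<open>Functionals given by integrating a jointly continuous integrand. The identity is
    demanded only for \<open>s\<close> in \<open>X \<times> A\<close> and \<open>M\<close> in
    \<open>prob_on X\<close>, where integrability makes the class stable under linear
    combinations.\<close>
  define \<Phi> :: "('x \<times> 'a \<Rightarrow> 'x measure \<Rightarrow> real) set" where "\<Phi> = {\<phi>. \<exists>k. continuous_on ((X \<times> A) \<times> X) (\<lambda>(s, x'). k s x') \<and>
    (\<forall>s\<in>X \<times> A. \<forall>M\<in>prob_on X. \<phi> s M = (\<integral>x'. k s x' \<partial>M))}"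
  \<comment> \<open>Index 0 carries the Bellman objective, which thereby has priority; the
    determining family is shifted to the indices from 1 on.\<close>
  define \<psi> where "\<psi> n s M = (case n of 0 \<Rightarrow> \<integral>x'. (f t (fst s) (snd s) x' + v x') \<partial>M | Suc m \<Rightarrow> \<integral>x'. h m x' \<partial>M)"
    for n and s :: "'x \<times> 'a" and M
  obtain p where p: "\<And>s. s \<in> space ?N \<Longrightarrow> p s \<in> argmin_on (\<psi> 0 s) (?K s)"
    and p_meas: "\<And>n. (\<lambda>s. \<psi> n s (p s)) \<in> borel_measurable ?N"
  proof (rule lexicographic_measurable_selection[where N="?N" and K="?K" and \<Phi>=\<Phi> and \<psi>=\<psi> and \<tau>="wasserstein_topology q X"])
    show "compactin (wasserstein_topology q X) (?K s)" "?K s \<noteq> {}" if "s \<in> space ?N" for s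
      using ambiguity_compact[OF t] that by auto
    show "continuous_map (wasserstein_topology q X) euclideanreal (\<phi> s)" if "\<phi> \<in> \<Phi>" "s \<in> space ?N" for \<phi> s
    proof -
      obtain k where k: "continuous_on ((X \<times> A) \<times> X) (\<lambda>(s, x'). k s x')"
        "\<forall>s\<in>X \<times> A. \<forall>M\<in>prob_on X. \<phi> s M = (\<integral>x'. k s x' \<partial>M)"
        using \<open>\<phi> \<in> \<Phi>\<close> unfolding \<Phi>_def by blast
      have s: "s \<in> X \<times> A" using that by simp
      have "continuous_map (wasserstein_topology q X) euclideanreal (\<lambda>M. \<integral>x'. k s x' \<partial>M)"
        by (rule continuous_map_wasserstein_integral[OF compact_X q continuous_on_slice[OF k(1) s]])
      then show ?thesis
        by (rule continuous_map_eq) (simp add: k(2)[rule_format, OF s])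
    qed
    show "(\<lambda>s M. \<phi> s M + real c * \<psi> s M) \<in> \<Phi>" if "\<phi> \<in> \<Phi>" "\<psi> \<in> \<Phi>" for \<phi> \<psi> c
    proof -
      obtain k where k: "continuous_on ((X \<times> A) \<times> X) (\<lambda>(s, x'). k s x')"
        "\<forall>s\<in>X \<times> A. \<forall>M\<in>prob_on X. \<phi> s M = (\<integral>x'. k s x' \<partial>M)"
        using \<open>\<phi> \<in> \<Phi>\<close> unfolding \<Phi>_def by blast
      obtain l where l: "continuous_on ((X \<times> A) \<times> X) (\<lambda>(s, x'). l s x')"
        "\<forall>s\<in>X \<times> A. \<forall>M\<in>prob_on X. \<psi> s M = (\<integral>x'. l s x' \<partial>M)"
        using \<open>\<psi> \<in> \<Phi>\<close> unfolding \<Phi>_def by blast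
      have "continuous_on ((X \<times> A) \<times> X) (\<lambda>(s, x'). k s x' + real c * l s x')"
        using k(1) l(1) unfolding case_prod_beta' by (intro continuous_intros)
      moreover have "\<phi> s M + real c * \<psi> s M = (\<integral>x'. k s x' + real c * l s x' \<partial>M)"
        if "s \<in> X \<times> A" "M \<in> prob_on X" for s M
        using prob_on_integrable_continuous[OF compact_X that(2) continuous_on_slice[OF k(1) that(1)]]
          prob_on_integrable_continuous[OF compact_X that(2) continuous_on_slice[OF l(1) that(1)]]
          k(2)[rule_format, OF that] l(2)[rule_format, OF that] by simp
      ultimately show ?thesis unfolding \<Phi>_def by blast
    qed
    show "(\<lambda>s. INF M\<in>?K s. \<phi> s M) \<in> borel_measurable ?N" if "\<phi> \<in> \<Phi>" for \<phi>
    proof -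
      obtain k where k: "continuous_on ((X \<times> A) \<times> X) (\<lambda>(s, x'). k s x')"
        "\<forall>s\<in>X \<times> A. \<forall>M\<in>prob_on X. \<phi> s M = (\<integral>x'. k s x' \<partial>M)"
        using \<open>\<phi> \<in> \<Phi>\<close> unfolding \<Phi>_def by blast
      have eq: "(INF M\<in>?K s. \<phi> s M) = (INF M\<in>?K s. \<integral>x'. k s x' \<partial>M)" if "s \<in> space ?N" for s
      proof (rule INF_cong[OF refl])
        have s: "s \<in> X \<times> A" using that by simp
        fix M assume "M \<in> ?K s"
        then have "M \<in> prob_on X"
          using ambiguity_prob_on[OF t, of "fst s" "snd s"] s by (auto simp: mem_Times_iff)
        then show "\<phi> s M = (\<integral>x'. k s x' \<partial>M)" by (rule k(2)[rule_format, OF s])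
      qed
      show ?thesis
        using measurable_cong[where M'=borel, OF eq]
          borel_measurable_continuous_on_restrict[OF ambiguity_INF_continuous[OF t k(1)]] by (rule iffD2)
    qed
    show "\<psi> n \<in> \<Phi>" for n
    proof (cases n)
      case 0
      show ?thesis
        unfolding \<Phi>_def 0 \<psi>_def mem_Collect_eq nat.case
        by (rule exI[of _ "\<lambda>s x'. f t (fst s) (snd s) x' + v x'"]) (use stage_reward_continuous[OF t v] in auto)
    next
      case (Suc m)
      have "continuous_on ((X \<times> A) \<times> X) (\<lambda>z. h m (snd z))"
        by (intro continuous_on_compose2[OF h[of m]] continuous_intros) auto
      then show ?thesis
        unfolding \<Phi>_def Suc \<psi>_def mem_Collect_eq nat.case
        by (intro exI[of _ "\<lambda>s x'. h m x'"]) (auto simp: case_prod_beta')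
    qed
  qed blast
  have pK: "p s \<in> ?K s" if "s \<in> X \<times> A" for s using p[of s] that by (simp add: argmin_on_def)
  have "p \<in> ?N \<rightarrow>\<^sub>M prob_algebra (borel_on X)"
  proof (rule h_det)
    show "X \<in> sets borel" using compact_imp_closed[OF compact_X] by simp
    show "p s \<in> prob_on X" if "s \<in> space ?N" for s
      using pK[of s] ambiguity_prob_on[OF t, of "fst s" "snd s"] that by (auto simp: mem_Times_iff)
    show "(\<lambda>s. \<integral>x. h n x \<partial>p s) \<in> borel_measurable ?N" for n
      using p_meas[of "Suc n"] by (simp add: \<psi>_def)
  qed
  then have "kernel_selection X A (\<P> t) p"
    using pK by (auto simp: kernel_selection_def)
  moreover have "worst_case t v x a = (\<integral>x'. (f t x a x' + v x') \<partial>p (x, a))" if "x \<in> X" "a \<in> A" for x a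
    using p[of "(x, a)"] that by (simp add: argmin_on_def \<psi>_def worst_case_def)
  ultimately show thesis
    by (intro that[of p]) (simp add: is_minimizer_def)
qed

section \<open>Rewards along paths and their expectations\<close>

lemma reward_measurable:
  "reward T f g t \<in> borel_measurable (path_space X A t T)" if "t \<le> T"
  unfolding reward_def[abs_def]
proof (intro borel_measurable_add borel_measurable_sum)
  fix l assume l: "l \<in> {t..<T}"
  have "(\<lambda>\<omega>. (state_at T l \<omega>, action_at l \<omega>, state_at T (Suc l) \<omega>)) \<in> path_space X A t T \<rightarrow>\<^sub>M borel_on (X \<times> A \<times> X)"
    using l by (intro Pair_measurable_borel_on state_at_measurable action_at_measurable) auto
  from measurable_compose[OF this borel_measurable_continuous_on_restrict[OF f_continuous]] l
  show "(\<lambda>\<omega>. f l (state_at T l \<omega>) (action_at l \<omega>) (state_at T (Suc l) \<omega>)) \<in> borel_measurable (path_space X A t T)"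
    by simp
next
  show "(\<lambda>\<omega>. g (state_at T T \<omega>)) \<in> borel_measurable (path_space X A t T)"
    by (rule measurable_compose[OF state_at_measurable[OF that] borel_measurable_continuous_on_restrict[OF g_continuous]])
qed

lemma reward_bounded:
  obtains B where "\<And>\<omega>. \<omega> \<in> space (path_space X A t T) \<Longrightarrow> \<bar>reward T f g t \<omega>\<bar> \<le> B"
proof (cases "t \<le> T")
  case True
  have "\<forall>l. \<exists>b. l < T \<longrightarrow> (\<forall>z\<in>X \<times> A \<times> X. \<bar>case z of (x, a, x') \<Rightarrow> f l x a x'\<bar> \<le> b)"
    using compact_continuous_bounded[OF compact_Times[OF compact_X compact_Times[OF compact_A compact_X]] f_continuous]
    by metis
  then obtain b where b: "\<And>l z. l < T \<Longrightarrow> z \<in> X \<times> A \<times> X \<Longrightarrow> \<bar>case z of (x, a, x') \<Rightarrow> f l x a x'\<bar> \<le> b l"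
    by metis
  obtain bg where bg: "\<And>x. x \<in> X \<Longrightarrow> \<bar>g x\<bar> \<le> bg"
    using compact_continuous_bounded[OF compact_X g_continuous] by metis
  show thesis
  proof (rule that[of "(\<Sum>l=t..<T. b l) + bg"])
    fix \<omega> assume \<omega>: "\<omega> \<in> space (path_space X A t T)"
    have st: "state_at T l \<omega> \<in> X" if "t \<le> l" for l
      using measurable_space[OF state_at_measurable[OF that] \<omega>] by simp
    have ac: "action_at l \<omega> \<in> A" if "l \<in> {t..<T}" for l
      using measurable_space[OF action_at_measurable[OF that] \<omega>] by simp
    have "\<bar>\<Sum>l=t..<T. f l (state_at T l \<omega>) (action_at l \<omega>) (state_at T (Suc l) \<omega>)\<bar> \<le> (\<Sum>l=t..<T. b l)"
    proof (rule order_trans[OF sum_abs sum_mono])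
      fix l assume "l \<in> {t..<T}"
      then show "\<bar>f l (state_at T l \<omega>) (action_at l \<omega>) (state_at T (Suc l) \<omega>)\<bar> \<le> b l"
        using b[of l "(state_at T l \<omega>, action_at l \<omega>, state_at T (Suc l) \<omega>)"] st ac by simp
    qed
    moreover have "\<bar>g (state_at T T \<omega>)\<bar> \<le> bg" using bg st True by blast
    ultimately show "\<bar>reward T f g t \<omega>\<bar> \<le> (\<Sum>l=t..<T. b l) + bg"
      unfolding reward_def by linarith
  qed
next
  case False
  obtain bg where bg: "\<And>x. x \<in> X \<Longrightarrow> \<bar>g x\<bar> \<le> bg"
    using compact_continuous_bounded[OF compact_X g_continuous] by metis
  \<comment> \<open>For \<open>t > T\<close> the sum is empty and only \<open>g\<close> at the last
    coordinate remains.\<close>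
  show thesis
    by (rule that[of bg]) (use False bg in \<open>auto simp: reward_def state_at_def space_path_space\<close>)
qed

definition expected_reward :: "(nat \<Rightarrow> 'x \<times> 'a \<Rightarrow> 'x measure) \<Rightarrow> nat \<Rightarrow> 'x \<Rightarrow> real" where
  "expected_reward P t x = (\<integral>\<omega>. reward T f g t \<omega> \<partial>path_measure X A T \<pi> P t x)"

definition selections :: "nat \<Rightarrow> (nat \<Rightarrow> 'x \<times> 'a \<Rightarrow> 'x measure) \<Rightarrow> bool" where
  "selections t P \<longleftrightarrow> (\<forall>l\<in>{t..<T}. kernel_selection X A (\<P> l) (P l))"

lemma selections_Suc: "selections t P \<Longrightarrow> selections (Suc t) P"
  by (simp add: selections_def)

lemma selectionD:
  assumes "selections t P" "t < T"
  shows "P t \<in> borel_on (X \<times> A) \<rightarrow>\<^sub>M prob_algebra (borel_on X)"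
    and "x \<in> X \<Longrightarrow> a \<in> A \<Longrightarrow> P t (x, a) \<in> \<P> t x a"
  using assms by (auto simp: selections_def kernel_selection_def)

lemma path_measure_measurable:
  assumes "selections t P" "t \<le> T"
  shows "path_measure X A T \<pi> P t \<in> borel_on X \<rightarrow>\<^sub>M prob_algebra (path_space X A t T)"
proof -
  have "path_steps X A \<pi> P (T - t) t \<in> borel_on X \<rightarrow>\<^sub>M prob_algebra (path_space X A t (t + (T - t)))"
    using assms policy_measurable
    by (intro path_steps_measurable) (auto simp: selections_def kernel_selection_def)
  then show ?thesis using assms(2) by (simp add: path_measure_def[abs_def])
qed

lemma expected_reward_measurable:
  assumes "selections t P" "t \<le> T"
  shows "expected_reward P t \<in> borel_measurable (borel_on X)"
  unfolding expected_reward_def[abs_def]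
  by (rule measurable_compose[OF measurable_prob_algebraD[OF path_measure_measurable[OF assms]]
        integral_measurable_subprob_algebra[OF reward_measurable[OF assms(2)]]])

text \<open>The bound is uniform over all selections, which keeps the infimum in the robust value
  bounded below.\<close>

lemma expected_reward_bounded:
  obtains B where "\<And>P x. selections t P \<Longrightarrow> t \<le> T \<Longrightarrow> x \<in> X \<Longrightarrow> \<bar>expected_reward P t x\<bar> \<le> B"
proof -
  obtain B where B: "\<And>\<omega>. \<omega> \<in> space (path_space X A t T) \<Longrightarrow> \<bar>reward T f g t \<omega>\<bar> \<le> B"
    using reward_bounded by metis
  have "\<bar>expected_reward P t x\<bar> \<le> B" if "selections t P" "t \<le> T" "x \<in> X" for P x
    unfolding expected_reward_def
    using measurable_space[OF path_measure_measurable[OF that(1,2)], of x] that B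
    by (intro prob_algebra_integrable(2)[OF _ reward_measurable]) auto
  then show thesis by (rule that)
qed

lemma expected_reward_terminal:
  assumes "x \<in> X"
  shows "expected_reward P T x = g x"
proof -
  have "(\<lambda>_. undefined, x) \<in> space (path_space X A T T)"
    using assms by (simp add: space_path_space)
  then show ?thesis
    by (simp add: expected_reward_def path_measure_def integral_return reward_measurable)
      (simp add: reward_def state_at_def)
qed

section \<open>One-step decomposition of path laws\<close>

lemma state_at_eq_pred:
  assumes "t \<le> T"
  shows "Measurable.pred (path_space X A t T) (\<lambda>\<omega>. state_at T t \<omega> = x)"
proof -
  have "state_at T t \<in> borel_measurable (path_space X A t T)"
    using state_at_measurable[of t t T X A] by (simp add: measurable_restrict_space2_iff)
  then show ?thesis by measurable
qed

lemma path_measure_Suc: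
  assumes "t < T"
  shows "path_measure X A T \<pi> P t x =
    \<pi> t x \<bind> (\<lambda>a. P t (x, a) \<bind> path_continuation X A \<pi> P (T - Suc t) t x a)"
proof -
  have "T - t = Suc (T - Suc t)" using assms by simp
  then show ?thesis unfolding path_measure_def by (simp only: path_steps_Suc)
qed

lemma path_continuation_eq:
  assumes "t < T"
  shows "path_continuation X A \<pi> P (T - Suc t) t x a x' =
    distr (path_measure X A T \<pi> P (Suc t) x') (path_space X A t T) (\<lambda>(h, y). (h(t := (x, a)), y))"
  using assms by (simp add: path_continuation_def path_measure_def)

lemma path_cons_measurable_path_space:
  assumes "t < T" "x \<in> X" "a \<in> A"
  shows "(\<lambda>(h, y). (h(t := (x, a)), y)) \<in> path_space X A (Suc t) T \<rightarrow>\<^sub>M path_space X A t T"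
proof -
  have "(\<lambda>_. (x, a)) \<in> path_space X A (Suc t) (Suc t + (T - Suc t)) \<rightarrow>\<^sub>M borel_on (X \<times> A)"
    using assms by (intro measurable_const) simp
  from path_cons_measurable[OF this measurable_ident] show ?thesis
    using assms by (simp add: case_prod_beta')
qed

lemma kernels_measurable:
  assumes "selections t P" "t < T"
  shows "(\<lambda>z. path_continuation X A \<pi> P (T - Suc t) t (fst (fst z)) (snd (fst z)) (snd z))
      \<in> (borel_on X \<Otimes>\<^sub>M borel_on A) \<Otimes>\<^sub>M borel_on X \<rightarrow>\<^sub>M prob_algebra (path_space X A t T)"
    and "(\<lambda>z. P t (fst z, snd z) \<bind> path_continuation X A \<pi> P (T - Suc t) t (fst z) (snd z))
      \<in> borel_on X \<Otimes>\<^sub>M borel_on A \<rightarrow>\<^sub>M prob_algebra (path_space X A t T)"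
proof -
  have m: "path_steps X A \<pi> P (T - Suc t) (Suc t)
      \<in> borel_on X \<rightarrow>\<^sub>M prob_algebra (path_space X A (Suc t) (Suc t + (T - Suc t)))"
    using path_measure_measurable[OF selections_Suc[OF assms(1)]] assms(2)
    by (simp add: path_measure_def[abs_def])
  note s = selectionD(1)[OF assms]
  show "(\<lambda>z. path_continuation X A \<pi> P (T - Suc t) t (fst (fst z)) (snd (fst z)) (snd z))
      \<in> (borel_on X \<Otimes>\<^sub>M borel_on A) \<Otimes>\<^sub>M borel_on X \<rightarrow>\<^sub>M prob_algebra (path_space X A t T)"
    using path_continuation_measurable[OF m] assms(2) by simp
  show "(\<lambda>z. P t (fst z, snd z) \<bind> path_continuation X A \<pi> P (T - Suc t) t (fst z) (snd z))
      \<in> borel_on X \<Otimes>\<^sub>M borel_on A \<rightarrow>\<^sub>M prob_algebra (path_space X A t T)"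
    using bind_path_continuation_measurable[OF m s] assms(2) by simp
qed

lemma kernels_measurable_section:
  assumes "selections t P" "t < T" "x \<in> X"
  shows "a \<in> A \<Longrightarrow> path_continuation X A \<pi> P (T - Suc t) t x a
      \<in> borel_on X \<rightarrow>\<^sub>M prob_algebra (path_space X A t T)"
    and "(\<lambda>a. P t (x, a) \<bind> path_continuation X A \<pi> P (T - Suc t) t x a)
      \<in> borel_on A \<rightarrow>\<^sub>M prob_algebra (path_space X A t T)"
proof -
  show "path_continuation X A \<pi> P (T - Suc t) t x a \<in> borel_on X \<rightarrow>\<^sub>M prob_algebra (path_space X A t T)"
    if "a \<in> A"
  proof -
    have "(\<lambda>x'. ((x, a), x')) \<in> borel_on X \<rightarrow>\<^sub>M (borel_on X \<Otimes>\<^sub>M borel_on A) \<Otimes>\<^sub>M borel_on X"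
      using assms(3) that by (intro measurable_Pair measurable_const measurable_ident) (auto simp: space_pair_measure)
    from measurable_compose[OF this kernels_measurable(1)[OF assms(1,2)]] show ?thesis by simp
  qed
  have "(\<lambda>a. (x, a)) \<in> borel_on A \<rightarrow>\<^sub>M borel_on X \<Otimes>\<^sub>M borel_on A"
    using assms(3) by (intro measurable_Pair measurable_const measurable_ident) auto
  from measurable_compose[OF this kernels_measurable(2)[OF assms(1,2)]]
  show "(\<lambda>a. P t (x, a) \<bind> path_continuation X A \<pi> P (T - Suc t) t x a)
      \<in> borel_on A \<rightarrow>\<^sub>M prob_algebra (path_space X A t T)" by simp
qed

text \<open>A path law records its starting point only as a coordinate of the random path.
  Identifying that coordinate almost surely lets the stage reward of the preceding time be evaluated
  at the state drawn by the kernel.\<close>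

lemma state_at_initial:
  assumes "selections t P" "t \<le> T" "x \<in> X"
  shows "AE \<omega> in path_measure X A T \<pi> P t x. state_at T t \<omega> = x"
proof (cases "t = T")
  case True
  have "(\<lambda>_. undefined, x) \<in> space (path_space X A T T)"
    using assms by (simp add: space_path_space)
  then have "AE \<omega> in return (path_space X A T T) (\<lambda>_. undefined, x). state_at T T \<omega> = x"
    by (subst AE_return[OF _ state_at_eq_pred]) (simp_all add: state_at_def)
  moreover have "path_measure X A T \<pi> P t x = return (path_space X A T T) (\<lambda>_. undefined, x)"
    by (simp add: True path_measure_def)
  ultimately show ?thesis by (simp only: True)
next
  case False
  then have t: "t < T" using assms by simp
  note pred = state_at_eq_pred[OF assms(2), of x]
  have \<pi>: "sets (\<pi> t x) = sets (borel_on A)" "space (\<pi> t x) = A"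
    using prob_onD[OF policy_prob_on[OF t assms(3)]] by auto
  have k2: "(\<lambda>a. P t (x, a) \<bind> path_continuation X A \<pi> P (T - Suc t) t x a)
      \<in> \<pi> t x \<rightarrow>\<^sub>M subprob_algebra (path_space X A t T)"
    unfolding measurable_cong_sets[OF \<pi>(1) refl]
    by (rule measurable_prob_algebraD[OF kernels_measurable_section(2)[OF assms(1) t assms(3)]])
  show ?thesis
    unfolding path_measure_Suc[OF t] AE_bind[OF k2 pred]
  proof (rule AE_I2)
    fix a assume "a \<in> space (\<pi> t x)"
    then have a: "a \<in> A" by (simp add: \<pi>)
    have P: "P t (x, a) \<in> prob_on X"
      using selectionD(2)[OF assms(1) t assms(3) a] ambiguity_prob_on[OF t assms(3) a] by blast
    have k1: "path_continuation X A \<pi> P (T - Suc t) t x a \<in> P t (x, a) \<rightarrow>\<^sub>M subprob_algebra (path_space X A t T)"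
      unfolding measurable_cong_sets[OF prob_onD(2)[OF P] refl]
      by (rule measurable_prob_algebraD[OF kernels_measurable_section(1)[OF assms(1) t assms(3) a]])
    show "AE \<omega> in P t (x, a) \<bind> path_continuation X A \<pi> P (T - Suc t) t x a. state_at T t \<omega> = x"
      unfolding AE_bind[OF k1 pred]
    proof (rule AE_I2)
      fix x' assume "x' \<in> space (P t (x, a))"
      then have x': "x' \<in> X" using prob_onD(3)[OF P] by simp
      have "path_measure X A T \<pi> P (Suc t) x' \<in> space (prob_algebra (path_space X A (Suc t) T))"
        using measurable_space[OF path_measure_measurable[OF selections_Suc[OF assms(1)]], of x'] t x' by simp
      then have sets: "sets (path_measure X A T \<pi> P (Suc t) x') = sets (path_space X A (Suc t) T)"
        by (simp add: space_prob_algebra)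
      have "(\<lambda>(h, y). (h(t := (x, a)), y)) \<in> path_measure X A T \<pi> P (Suc t) x' \<rightarrow>\<^sub>M path_space X A t T"
        unfolding measurable_cong_sets[OF sets refl] by (rule path_cons_measurable_path_space[OF t assms(3) a])
      \<comment> \<open>For \<open>t < T\<close> the state at time \<open>t\<close> is read from
        coordinate \<open>t\<close>, just overwritten with \<open>(x, a)\<close>, so the property
        holds for every path.\<close>
      then show "AE \<omega> in path_continuation X A \<pi> P (T - Suc t) t x a x'. state_at T t \<omega> = x"
        unfolding path_continuation_eq[OF t]
        using pred by (subst AE_distr_iff) (auto simp: state_at_def t split_beta' pred_def)
    qed
  qed
qed

text \<open>Overwriting coordinate \<open>t\<close> leaves the later summands alone. The next state
  is that of the tail, also when \<open>Suc t = T\<close> and it is the terminal point.\<close>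

lemma reward_path_cons:
  assumes "t < T"
  shows "reward T f g t (h(t := (x, a)), y) =
    f t x a (state_at T (Suc t) (h, y)) + reward T f g (Suc t) (h, y)"
proof -
  have "(\<Sum>l=t..<T. f l (state_at T l (h(t := (x, a)), y)) (action_at l (h(t := (x, a)), y)) (state_at T (Suc l) (h(t := (x, a)), y)))
    = f t x a (state_at T (Suc t) (h, y)) +
      (\<Sum>l=Suc t..<T. f l (state_at T l (h, y)) (action_at l (h, y)) (state_at T (Suc l) (h, y)))"
    unfolding sum.atLeast_Suc_lessThan[OF assms]
    by (intro arg_cong2[where f="(+)"] sum.cong refl) (auto simp: state_at_def action_at_def assms)
  then show ?thesis by (simp add: reward_def state_at_def)
qed

text \<open>The first state of the tail is almost surely \<open>x'\<close>, so the stage reward is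
  constant under the tail law and leaves the integral.\<close>

lemma integral_path_continuation:
  assumes "selections t P" "t < T" "x \<in> X" "a \<in> A" "x' \<in> X"
  shows "(\<integral>\<omega>. reward T f g t \<omega> \<partial>path_continuation X A \<pi> P (T - Suc t) t x a x') =
    f t x a x' + expected_reward P (Suc t) x'"
proof -
  let ?M = "path_measure X A T \<pi> P (Suc t) x'"
  have t: "t \<le> T" "Suc t \<le> T" using assms by auto
  have M: "?M \<in> space (prob_algebra (path_space X A (Suc t) T))"
    using measurable_space[OF path_measure_measurable[OF selections_Suc[OF assms(1)] t(2)], of x'] assms by simp
  then have sets: "sets ?M = sets (path_space X A (Suc t) T)" and prob: "prob_space ?M"
    by (auto simp: space_prob_algebra)
  interpret prob_space ?M by (fact prob)
  have cons: "(\<lambda>(h, y). (h(t := (x, a)), y)) \<in> ?M \<rightarrow>\<^sub>M path_space X A t T"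
    unfolding measurable_cong_sets[OF sets refl] by (rule path_cons_measurable_path_space[OF assms(2-4)])
  obtain B where B: "\<And>\<omega>. \<omega> \<in> space (path_space X A (Suc t) T) \<Longrightarrow> \<bar>reward T f g (Suc t) \<omega>\<bar> \<le> B"
    using reward_bounded by metis
  have int: "integrable ?M (reward T f g (Suc t))"
    by (rule prob_algebra_integrable(1)[OF M reward_measurable[OF t(2)] B])
  have m: "reward T f g (Suc t) \<in> borel_measurable ?M" using int by (rule borel_measurable_integrable)
  have "(\<integral>\<omega>. reward T f g t \<omega> \<partial>path_continuation X A \<pi> P (T - Suc t) t x a x')
    = (\<integral>\<omega>. reward T f g t (case \<omega> of (h, y) \<Rightarrow> (h(t := (x, a)), y)) \<partial>?M)"
    unfolding path_continuation_eq[OF assms(2)] by (rule integral_distr[OF cons reward_measurable[OF t(1)]])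
  also have "\<dots> = (\<integral>\<omega>. f t x a x' + reward T f g (Suc t) \<omega> \<partial>?M)"
  proof (rule integral_cong_AE)
    show "(\<lambda>\<omega>. reward T f g t (case \<omega> of (h, y) \<Rightarrow> (h(t := (x, a)), y))) \<in> borel_measurable ?M"
      by (rule measurable_compose[OF cons reward_measurable[OF t(1)]])
    show "(\<lambda>\<omega>. f t x a x' + reward T f g (Suc t) \<omega>) \<in> borel_measurable ?M" using m by simp
    show "AE \<omega> in ?M. reward T f g t (case \<omega> of (h, y) \<Rightarrow> (h(t := (x, a)), y)) =
        f t x a x' + reward T f g (Suc t) \<omega>"
      using state_at_initial[OF selections_Suc[OF assms(1)] t(2) assms(5)]
    proof eventually_elim
      case (elim \<omega>)
      then show ?case
        using reward_path_cons[OF assms(2), of "fst \<omega>" x a "snd \<omega>"] by (simp add: case_prod_beta')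
    qed
  qed
  also have "\<dots> = f t x a x' + expected_reward P (Suc t) x'"
    using int by (simp add: expected_reward_def prob_space)
  finally show ?thesis .
qed

text \<open>Integrating through the two binds, over the action and then over the next state, reduces
  the claim to the innermost law; boundedness of the total reward justifies both exchanges.
  Integrability is recorded for the later use of monotonicity.\<close>

lemma expected_reward_Suc:
  assumes "selections t P" "t < T" "x \<in> X"
  shows "expected_reward P t x =
      (\<integral>a. (\<integral>x'. (f t x a x' + expected_reward P (Suc t) x') \<partial>P t (x, a)) \<partial>\<pi> t x)"
    and "integrable (\<pi> t x) (\<lambda>a. \<integral>x'. (f t x a x' + expected_reward P (Suc t) x') \<partial>P t (x, a))"
proof -
  let ?I = "\<lambda>a. \<integral>x'. (f t x a x' + expected_reward P (Suc t) x') \<partial>P t (x, a)"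
  let ?k = "\<lambda>a. P t (x, a) \<bind> path_continuation X A \<pi> P (T - Suc t) t x a"
  have t: "t \<le> T" using assms by simp
  obtain B where B: "\<And>\<omega>. \<omega> \<in> space (path_space X A t T) \<Longrightarrow> \<bar>reward T f g t \<omega>\<bar> \<le> B"
    using reward_bounded by metis
  note k = kernels_measurable_section[OF assms]
  note \<pi> = policy_prob_on[OF assms(2,3)]
  have inner: "(\<integral>\<omega>. reward T f g t \<omega> \<partial>?k a) = ?I a" if a: "a \<in> A" for a
  proof -
    have P: "P t (x, a) \<in> prob_on X"
      using selectionD(2)[OF assms(1,2,3) a] ambiguity_prob_on[OF assms(2,3) a] by blast
    have "(\<integral>\<omega>. reward T f g t \<omega> \<partial>?k a) =
        (\<integral>x'. (\<integral>\<omega>. reward T f g t \<omega> \<partial>path_continuation X A \<pi> P (T - Suc t) t x a x') \<partial>P t (x, a))"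
      by (rule prob_algebra_integral_bind[OF P k(1)[OF a] reward_measurable[OF t] B])
    also have "\<dots> = ?I a"
      using integral_path_continuation[OF assms a] prob_onD(3)[OF P]
      by (intro Bochner_Integration.integral_cong) auto
    finally show ?thesis .
  qed
  have "expected_reward P t x = (\<integral>a. (\<integral>\<omega>. reward T f g t \<omega> \<partial>?k a) \<partial>\<pi> t x)"
    unfolding expected_reward_def path_measure_Suc[OF assms(2)]
    by (rule prob_algebra_integral_bind[OF \<pi> k(2) reward_measurable[OF t] B])
  also have "\<dots> = (\<integral>a. ?I a \<partial>\<pi> t x)"
    using inner prob_onD(3)[OF \<pi>] by (intro Bochner_Integration.integral_cong) auto
  finally show "expected_reward P t x = (\<integral>a. ?I a \<partial>\<pi> t x)" .
  show "integrable (\<pi> t x) ?I"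
  proof (rule prob_algebra_integrable(1)[OF \<pi>])
    \<comment> \<open>Measurability of \<open>?I\<close> in the action is inherited from the
      expected total reward under \<open>?k a\<close>, with which it agrees on
      \<open>A\<close>.\<close>
    have "(\<lambda>a. \<integral>\<omega>. reward T f g t \<omega> \<partial>?k a) \<in> borel_measurable (borel_on A)"
      by (rule measurable_compose[OF measurable_prob_algebraD[OF k(2)]
            integral_measurable_subprob_algebra[OF reward_measurable[OF t]]])
    then show "?I \<in> borel_measurable (borel_on A)"
      by (subst measurable_cong[where g="\<lambda>a. \<integral>\<omega>. reward T f g t \<omega> \<partial>?k a"]) (auto simp: inner)
    fix a assume "a \<in> space (borel_on A)"
    then have a: "a \<in> A" by simp
    have "?k a \<in> space (prob_algebra (path_space X A t T))"
      using measurable_space[OF k(2), of a] a by simp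
    then show "\<bar>?I a\<bar> \<le> B"
      unfolding inner[OF a, symmetric] by (rule prob_algebra_integrable(2)[OF _ reward_measurable[OF t] B])
  qed
qed

section \<open>Bellman integrals compared with expected rewards\<close>

lemma worst_case_integrable:
  assumes "t < T" "continuous_on X v" "x \<in> X"
  shows "integrable (\<pi> t x) (worst_case t v x)"
  by (rule prob_on_integrable_continuous[OF compact_A policy_prob_on[OF assms(1,3)]
        continuous_on_slice[OF worst_case_continuous[OF assms(1,2)] assms(3)]])

text \<open>For a general selection the expected reward is known only to be bounded and measurable
  in the state, whereas \<open>f\<close> is continuous, so the two summands are integrable for
  different reasons.\<close>

lemma stage_integrable:
  assumes "selections t P" "t < T" "x \<in> X" "a \<in> A"
  shows "integrable (P t (x, a)) (\<lambda>x'. f t x a x' + expected_reward P (Suc t) x')"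
proof -
  have P: "P t (x, a) \<in> prob_on X"
    using selectionD(2)[OF assms] ambiguity_prob_on[OF assms(2-4)] by blast
  \<comment> \<open>The zero continuation value isolates the continuity of
    \<open>f t x a\<close>.\<close>
  have "continuous_on X (\<lambda>x'. f t x a x' + 0)"
    using assms by (intro stage_reward_slice_continuous) auto
  then have "integrable (P t (x, a)) (f t x a)"
    using prob_on_integrable_continuous[OF compact_X P] by simp
  moreover obtain B where "\<And>x. x \<in> X \<Longrightarrow> \<bar>expected_reward P (Suc t) x\<bar> \<le> B"
    using expected_reward_bounded[of "Suc t"] selections_Suc[OF assms(1)] assms(2) by (metis Suc_leI)
  then have "integrable (P t (x, a)) (expected_reward P (Suc t))"
    using expected_reward_measurable[OF selections_Suc[OF assms(1)]] assms(2)
    by (intro prob_algebra_integrable(1)[OF P]) auto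
  ultimately show ?thesis by simp
qed

text \<open>At each action \<open>P t (x, a)\<close> is one competitor in the worst case, and
  replacing \<open>v\<close> by a larger continuation can only raise its integral.\<close>

lemma Bellman_le_expected_reward:
  assumes "selections t P" "t < T" "x \<in> X" "continuous_on X v"
    and v: "\<And>x'. x' \<in> X \<Longrightarrow> v x' \<le> expected_reward P (Suc t) x'"
  shows "(\<integral>a. worst_case t v x a \<partial>\<pi> t x) \<le> expected_reward P t x"
  unfolding expected_reward_Suc(1)[OF assms(1-3)]
proof (rule integral_mono[OF worst_case_integrable[OF assms(2,4,3)] expected_reward_Suc(2)[OF assms(1-3)]])
  fix a assume "a \<in> space (\<pi> t x)"
  then have a: "a \<in> A" using prob_onD(3)[OF policy_prob_on[OF assms(2,3)]] by simp
  note P = selectionD(2)[OF assms(1-3) a]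
  have P': "P t (x, a) \<in> prob_on X" using P ambiguity_prob_on[OF assms(2,3) a] by blast
  have "worst_case t v x a \<le> (\<integral>x'. (f t x a x' + v x') \<partial>P t (x, a))"
    by (rule worst_case_le[OF assms(2,4,3) a P])
  also have "\<dots> \<le> (\<integral>x'. (f t x a x' + expected_reward P (Suc t) x') \<partial>P t (x, a))"
    using prob_on_integrable_continuous[OF compact_X P' stage_reward_slice_continuous[OF assms(2,4,3) a]]
      stage_integrable[OF assms(1-3) a] v prob_onD(3)[OF P']
    by (intro integral_mono) auto
  finally show "worst_case t v x a \<le> (\<integral>x'. (f t x a x' + expected_reward P (Suc t) x') \<partial>P t (x, a))" .
qed

lemma expected_reward_minimizer:
  assumes "selections t P" "t < T" "x \<in> X" "is_minimizer t v (P t)"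
    and v: "\<And>x'. x' \<in> X \<Longrightarrow> expected_reward P (Suc t) x' = v x'"
  shows "expected_reward P t x = (\<integral>a. worst_case t v x a \<partial>\<pi> t x)"
  unfolding expected_reward_Suc(1)[OF assms(1-3)]
proof (rule Bochner_Integration.integral_cong[OF refl])
  fix a assume "a \<in> space (\<pi> t x)"
  then have a: "a \<in> A" using prob_onD(3)[OF policy_prob_on[OF assms(2,3)]] by simp
  have P: "P t (x, a) \<in> prob_on X"
    using selectionD(2)[OF assms(1-3) a] ambiguity_prob_on[OF assms(2,3) a] by blast
  have "(\<integral>x'. (f t x a x' + expected_reward P (Suc t) x') \<partial>P t (x, a)) = (\<integral>x'. (f t x a x' + v x') \<partial>P t (x, a))"
    using v prob_onD(3)[OF P] by (intro Bochner_Integration.integral_cong) auto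
  then show "(\<integral>x'. (f t x a x' + expected_reward P (Suc t) x') \<partial>P t (x, a)) = worst_case t v x a"
    using assms(3,4) a by (simp add: is_minimizer_def)
qed

section \<open>Robust value and backward recursion\<close>

abbreviation val :: "nat \<Rightarrow> 'x \<Rightarrow> real" where
  "val \<equiv> robust_value X A T \<P> f g \<pi>"

text \<open>Path laws are parametrized by kernel sequences, several of which may give the same law,
  so the infimum can be bounded one sequence at a time.\<close>

lemma value_eq: "val t x = (INF P\<in>Collect (selections t). expected_reward P t x)"
proof -
  have "path_measures X A T \<P> \<pi> t x = (\<lambda>P. path_measure X A T \<pi> P t x) ` Collect (selections t)"
    by (auto simp: path_measures_def selections_def)
  then show ?thesis
    by (simp add: robust_value_def expected_reward_def image_image)
qed

lemma value_le:
  assumes "selections t P" "t \<le> T" "x \<in> X"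
  shows "val t x \<le> expected_reward P t x"
proof -
  obtain B where B: "\<And>P. selections t P \<Longrightarrow> \<bar>expected_reward P t x\<bar> \<le> B"
    using expected_reward_bounded assms by metis
  have "bdd_below ((\<lambda>P. expected_reward P t x) ` Collect (selections t))"
    by (rule bdd_belowI2[where m="- B"]) (use B in \<open>auto simp: abs_le_iff minus_le_iff\<close>)
  then show ?thesis unfolding value_eq using assms by (intro cINF_lower) auto
qed

text \<open>Each kernel minimizes against the robust value at the next time, not against the
  expected reward generated by the later kernels. The conditions at different times are therefore
  separate, and a sequence can be completed by changing a single entry.\<close>

definition minimizers :: "nat \<Rightarrow> (nat \<Rightarrow> 'x \<times> 'a \<Rightarrow> 'x measure) \<Rightarrow> bool" where
  "minimizers t P \<longleftrightarrow> (\<forall>l\<in>{t..<T}. is_minimizer l (val (Suc l)) (P l))"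

lemma minimizers_imp_selections: "minimizers t P \<Longrightarrow> selections t P"
  by (simp add: minimizers_def selections_def is_minimizer_def)

lemma value_terminal: "x \<in> X \<Longrightarrow> val T x = g x"
proof -
  have "Collect (selections T) = UNIV" by (auto simp: selections_def)
  then show "x \<in> X \<Longrightarrow> val T x = g x"
    by (simp add: value_eq expected_reward_terminal)
qed

text \<open>Every selection dominates the Bellman integral, because its tail has expected reward at
  least \<open>val (Suc t)\<close>; a minimizing sequence reaches it with equality.
  \<open>P0\<close> supplies the competitor for the upper bound and makes the set of selections
  nonempty.\<close>

lemma value_step:
  assumes t: "t < T" and cont: "continuous_on X (val (Suc t))"
    and attained: "\<And>P x. minimizers (Suc t) P \<Longrightarrow> x \<in> X \<Longrightarrow> expected_reward P (Suc t) x = val (Suc t) x"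
    and ex: "minimizers t P0" and x: "x \<in> X"
  shows "val t x = (\<integral>a. worst_case t (val (Suc t)) x a \<partial>\<pi> t x)"
    and "minimizers t P \<Longrightarrow> expected_reward P t x = val t x"
proof -
  let ?b = "\<integral>a. worst_case t (val (Suc t)) x a \<partial>\<pi> t x"
  have eq: "expected_reward P t x = ?b" if "minimizers t P" for P
  proof (rule expected_reward_minimizer[OF minimizers_imp_selections[OF that] t x])
    show "is_minimizer t (val (Suc t)) (P t)" using that t by (simp add: minimizers_def)
    show "expected_reward P (Suc t) x' = val (Suc t) x'" if "x' \<in> X" for x'
      using \<open>minimizers t P\<close> that by (intro attained) (simp_all add: minimizers_def)
  qed
  have "?b \<le> val t x"
    unfolding value_eq
  proof (rule cINF_greatest)
    show "Collect (selections t) \<noteq> {}" using minimizers_imp_selections[OF ex] by blast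
    fix P assume "P \<in> Collect (selections t)"
    then have P: "selections t P" by simp
    \<comment> \<open>Unfolding \<open>value_eq\<close> has also expanded the value at
      \<open>Suc t\<close> inside the integral; it is folded back before the comparison.\<close>
    show "(\<integral>a. worst_case t (\<lambda>x. INF P\<in>Collect (selections (Suc t)). expected_reward P (Suc t) x) x a \<partial>\<pi> t x)
        \<le> expected_reward P t x"
      unfolding value_eq[symmetric]
      using value_le[OF selections_Suc[OF P]] t by (intro Bellman_le_expected_reward[OF P t x cont]) auto
  qed
  moreover have "val t x \<le> ?b"
    using value_le[OF minimizers_imp_selections[OF ex] less_imp_le[OF t] x] eq[OF ex] by simp
  ultimately show v: "val t x = ?b" by simp
  show "expected_reward P t x = val t x" if "minimizers t P" using eq[OF that] v by simp
qed

text \<open>The three claims feed each other: continuity at \<open>Suc t\<close> gives a minimizing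
  kernel at \<open>t\<close>, attainment at \<open>Suc t\<close> enters the Bellman equation at
  \<open>t\<close>, and that equation gives continuity at \<open>t\<close>. Attainment is asserted
  for every minimizing sequence, since the optimal path law may be built from any choice of
  minimizers.\<close>

lemma backward_induction:
  assumes "t \<le> T"
  shows "continuous_on X (val t) \<and> (\<exists>P. minimizers t P) \<and>
    (\<forall>P. minimizers t P \<longrightarrow> (\<forall>x\<in>X. expected_reward P t x = val t x))"
  using assms
proof (induction t rule: inc_induct)
  case base
  have "continuous_on X (val T)"
    using g_continuous value_terminal by (simp cong: continuous_on_cong)
  \<comment> \<open>No time remains at \<open>T\<close>, so every kernel sequence counts as
    minimizing.\<close>
  then show ?case
    by (auto simp: minimizers_def expected_reward_terminal value_terminal)
next
  case (step t)
  then have t: "t < T" and cont: "continuous_on X (val (Suc t))"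
    and attained: "\<And>P x. minimizers (Suc t) P \<Longrightarrow> x \<in> X \<Longrightarrow> expected_reward P (Suc t) x = val (Suc t) x"
    by auto
  obtain P1 where P1: "minimizers (Suc t) P1" using step by blast
  obtain p where "is_minimizer t (val (Suc t)) p" using minimizer_exists[OF t cont] by blast
  \<comment> \<open>Changing the entry at \<open>t\<close> does not touch the conditions from
    \<open>Suc t\<close> on.\<close>
  with P1 have ex: "minimizers t (P1(t := p))" by (auto simp: minimizers_def)
  note v = value_step[OF t cont attained ex]
  have "continuous_on X (val t)"
    using Bellman_continuous[OF t cont] v(1) by (simp cong: continuous_on_cong)
  with ex v(2) show ?case by blast
qed

lemma value_Bellman:
  assumes "t < T" "x \<in> X"
  shows "val t x = (\<integral>a. worst_case t (val (Suc t)) x a \<partial>\<pi> t x)"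
proof -
  obtain P where "minimizers t P" using backward_induction[of t] assms by auto
  then show ?thesis
    using backward_induction[of "Suc t"] assms by (intro value_step(1)) auto
qed

end

theorem theorem2p1:
  fixes X :: "'x::euclidean_space set" and A :: "'a::euclidean_space set"
    and T :: nat and q :: real
    and \<P> :: "nat \<Rightarrow> 'x \<Rightarrow> 'a \<Rightarrow> 'x measure set"
    and f :: "nat \<Rightarrow> 'x \<Rightarrow> 'a \<Rightarrow> 'x \<Rightarrow> real" and g :: "'x \<Rightarrow> real"
  assumes "compact X" and "X \<noteq> {}" and "compact A" and "A \<noteq> {}" and "T \<ge> 1" and "q \<ge> 1"
    and "\<And>t. t < T \<Longrightarrow> (\<lambda>(x, a, x'). f t x a x') \<in> borel_measurable (borel_on (X \<times> A \<times> X))"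
    and "g \<in> borel_measurable (borel_on X)"
    and "\<And>t x a. t < T \<Longrightarrow> x \<in> X \<Longrightarrow> a \<in> A \<Longrightarrow>
           \<P> t x a \<noteq> {} \<and> compactin (wasserstein_topology q X) (\<P> t x a)"
    and "\<And>t x a xs as. t < T \<Longrightarrow> x \<in> X \<Longrightarrow> a \<in> A \<Longrightarrow>
           (\<And>n. xs n \<in> X) \<Longrightarrow> (\<And>n. as n \<in> A) \<Longrightarrow> (\<lambda>n. (xs n, as n)) \<longlonglongrightarrow> (x, a) \<Longrightarrow>
           (\<lambda>n. hausdorff_wasserstein q (\<P> t (xs n) (as n)) (\<P> t x a)) \<longlonglongrightarrow> 0"
    and "\<exists>C\<ge>1. \<forall>t<T. \<forall>x\<in>X. \<forall>a\<in>A. \<forall>M\<in>\<P> t x a.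
           (\<integral>x'. (1 + norm x' powr q) \<partial>M) \<le> C * (1 + norm x powr q + norm a powr q)"
    and "\<And>t. t < T \<Longrightarrow> continuous_on (X \<times> A \<times> X) (\<lambda>(x, a, x'). f t x a x')"
    and "continuous_on X g"
  shows
    "\<forall>\<pi>. admissible q X A T \<pi> \<longrightarrow>
       (let V = robust_value X A T \<P> f g \<pi>;
            F = (\<lambda>t x a M. \<integral>x'. (f t x a x' + V (Suc t) x') \<partial>M);
            minimizer = (\<lambda>t P. kernel_selection X A (\<P> t) P \<and>
              (\<forall>x\<in>X. \<forall>a\<in>A. (INF M\<in>\<P> t x a. F t x a M) = F t x a (P (x, a))))
        in
          (\<forall>x\<in>X. V T x = g x) \<and>
          (\<forall>t<T. \<forall>x\<in>X. V t x = (\<integral>a. (INF M\<in>\<P> t x a. F t x a M) \<partial>\<pi> t x)) \<and>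
          (\<forall>t\<le>T. continuous_on X (V t)) \<and>
          (\<forall>t<T. \<exists>P. minimizer t P) \<and>
          (\<forall>P. (\<forall>t<T. minimizer t (P t)) \<longrightarrow>
            (\<forall>x\<in>X.
              V 0 x = (INF M\<in>path_measures X A T \<P> \<pi> 0 x. \<integral>\<omega>. reward T f g 0 \<omega> \<partial>M) \<and>
              (INF M\<in>path_measures X A T \<P> \<pi> 0 x. \<integral>\<omega>. reward T f g 0 \<omega> \<partial>M) =
                (\<integral>\<omega>. reward T f g 0 \<omega> \<partial>path_measure X A T \<pi> P 0 x))))"
proof (intro allI impI)
  fix \<pi> assume adm: "admissible q X A T \<pi>"
  interpret robust_control X A T q \<P> f g \<pi>
    by (rule robust_control.intro) (fact assms adm)+
  \<comment> \<open>Matches the \<open>let\<close>-bound minimizer condition with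
    \<open>is_minimizer\<close>, so that the unfolded goal is phrased in terms of the
    locale.\<close>
  have min: "kernel_selection X A (\<P> t) P \<and> (\<forall>x\<in>X. \<forall>a\<in>A.
      (INF M\<in>\<P> t x a. \<integral>x'. (f t x a x' + val (Suc t) x') \<partial>M) =
      (\<integral>x'. (f t x a x' + val (Suc t) x') \<partial>P (x, a))) \<longleftrightarrow> is_minimizer t (val (Suc t)) P" for t P
    by (simp add: is_minimizer_def worst_case_def)
  show "let V = val;
            F = (\<lambda>t x a M. \<integral>x'. (f t x a x' + V (Suc t) x') \<partial>M);
            minimizer = (\<lambda>t P. kernel_selection X A (\<P> t) P \<and>
              (\<forall>x\<in>X. \<forall>a\<in>A. (INF M\<in>\<P> t x a. F t x a M) = F t x a (P (x, a))))
        in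
          (\<forall>x\<in>X. V T x = g x) \<and>
          (\<forall>t<T. \<forall>x\<in>X. V t x = (\<integral>a. (INF M\<in>\<P> t x a. F t x a M) \<partial>\<pi> t x)) \<and>
          (\<forall>t\<le>T. continuous_on X (V t)) \<and>
          (\<forall>t<T. \<exists>P. minimizer t P) \<and>
          (\<forall>P. (\<forall>t<T. minimizer t (P t)) \<longrightarrow>
            (\<forall>x\<in>X.
              V 0 x = (INF M\<in>path_measures X A T \<P> \<pi> 0 x. \<integral>\<omega>. reward T f g 0 \<omega> \<partial>M) \<and>
              (INF M\<in>path_measures X A T \<P> \<pi> 0 x. \<integral>\<omega>. reward T f g 0 \<omega> \<partial>M) =
                (\<integral>\<omega>. reward T f g 0 \<omega> \<partial>path_measure X A T \<pi> P 0 x)))"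
    unfolding Let_def min
  proof (intro conjI ballI allI impI)
    show "val T x = g x" if "x \<in> X" for x
      using that by (rule value_terminal)
    show "val t x = (\<integral>a. (INF M\<in>\<P> t x a. \<integral>x'. (f t x a x' + val (Suc t) x') \<partial>M) \<partial>\<pi> t x)"
      if "t < T" "x \<in> X" for t x
      using value_Bellman[OF that] by (simp only: worst_case_def)
    show "continuous_on X (val t)" if "t \<le> T" for t
      using backward_induction[OF that] by blast
    show "\<exists>P. is_minimizer t (val (Suc t)) P" if "t < T" for t
      using minimizer_exists[OF that] backward_induction[of "Suc t"] that by (metis Suc_leI)
    fix P x assume "\<forall>t<T. is_minimizer t (val (Suc t)) (P t)" and x: "x \<in> X"
    \<comment> \<open>The given kernels form a minimizing sequence from time 0 on, so their path law
      attains the value whichever minimizers were chosen.\<close>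
    then have "expected_reward P 0 x = val 0 x"
      using backward_induction[of 0] by (simp add: minimizers_def)
    then show "(INF M\<in>path_measures X A T \<P> \<pi> 0 x. \<integral>\<omega>. reward T f g 0 \<omega> \<partial>M) =
        (\<integral>\<omega>. reward T f g 0 \<omega> \<partial>path_measure X A T \<pi> P 0 x)"
      by (simp add: expected_reward_def robust_value_def)
  qed (simp add: robust_value_def)
qed

end
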